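(* Let $q\in L^\infty[0,1]$ be real valued. For $1/2<\alpha<1$ let $N(\alpha)$ denote the number of real eigenvalues of the problem $$-{}^{c}\mathcal{D}_{0^+}^{\alpha}\circ\mathcal{D}_{0^+}^{\alpha}y(t)+q(t)y(t)=\lambda y(t),\quad 0\le t\le 1,\qquad \mathcal{I}_{0^+}^{1-\alpha}y(t)|_{t=0}=0,\quad \mathcal{I}_{0^+}^{1-\alpha}y(t)|_{t=1}=0,$$ with eigenfunctions in $C[0,1]$. Then $N(\alpha)\to\infty$ as $\alpha\to 1^-$.
   Context: For $\beta>0$ the left Riemann-Liouville fractional integral is $\mathcal{I}_{0^+}^{\beta}f(t)=\frac{1}{\Gamma(\beta)}\int_0^t (t-s)^{\beta-1}f(s)\,ds$. For $0<\alpha<1$ the left Riemann-Liouville derivative is $\mathcal{D}_{0^+}^{\alpha}f=\frac{d}{dt}\mathcal{I}_{0^+}^{1-\alpha}f$ and the left Caputo derivative is ${}^{c}\mathcal{D}_{0^+}^{\alpha}f=\mathcal{I}_{0^+}^{1-\alpha}(f')$. Solutions of the differential equation are understood through the equivalent integral equation. A solution $y\in C[0,1]$ of the equation with $\mathcal{I}_{0^+}^{1-\alpha}y|_{t=0}=0$ is a continuous function $y:[0,1]\to\mathbb{C}$ such that, for some constant $c_2\in\mathbb{C}$ (namely $c_2=\mathcal{D}_{0^+}^{\alpha}y|_{t=0}$), $$y(t)=c_2\frac{t^{\alpha}}{\Gamma(\alpha+1)}+\frac{1}{\Gamma(2\alpha)}\int_0^t (t-s)^{2\alpha-1}(q(s)-\lambda)y(s)\,ds,\qquad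 t\in[0,1].$$ A number $\lambda\in\mathbb{C}$ is an eigenvalue if there is such a solution $y\not\equiv 0$ with $\mathcal{I}_{0^+}^{1-\alpha}y(t)|_{t=1}=0$. *)

theory Defs
  imports "HOL-Analysis.Analysis"
begin

definition L_infinity_01 :: "(real \<Rightarrow> real) \<Rightarrow> bool" where
  "L_infinity_01 q \<longleftrightarrow>
     q \<in> borel_measurable (lebesgue_on {0..1}) \<and>
     (\<exists>C. AE s in lebesgue_on {0..1}. \<bar>q s\<bar> \<le> C)"

definition RL_integral :: "real \<Rightarrow> (real \<Rightarrow> complex) \<Rightarrow> real \<Rightarrow> complex" where
  "RL_integral \<beta> f t =
     complex_of_real (1 / Gamma \<beta>) *
     (LINT s:{0..t}|lebesgue. complex_of_real ((t - s) powr (\<beta> - 1)) * f s)"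

text \<open>
  Continuous solutions on $[0,1]$ of the equation with fractional integral of order $1-\alpha$
  vanishing at $t = 0$, understood through the equivalent integral equation.  The initial
  condition is what removes the singular term $c_1 t^{\alpha-1}$; the free constant $c_2$ is the
  value at $0$ of the Riemann-Liouville derivative of order $\alpha$ of $y$.
  Values of \<open>y\<close> outside $[0,1]$ are irrelevant.
\<close>
definition is_solution :: "real \<Rightarrow> (real \<Rightarrow> real) \<Rightarrow> complex \<Rightarrow> (real \<Rightarrow> complex) \<Rightarrow> bool" where
  "is_solution \<alpha> q \<mu> y \<longleftrightarrow>
     continuous_on {0..1} y \<and>
     (\<exists>c\<^sub>2::complex. \<forall>t\<in>{0..1}.
        y t = c\<^sub>2 * complex_of_real (t powr \<alpha> / Gamma (\<alpha> + 1))
              + RL_integral (2 * \<alpha>) (\<lambda>s. (complex_of_real (q s) - \<mu>) * y s) t)"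

definition is_eigenvalue :: "real \<Rightarrow> (real \<Rightarrow> real) \<Rightarrow> complex \<Rightarrow> bool" where
  "is_eigenvalue \<alpha> q \<mu> \<longleftrightarrow>
     (\<exists>y. is_solution \<alpha> q \<mu> y \<and> (\<exists>t\<in>{0..1}. y t \<noteq> 0) \<and> RL_integral (1 - \<alpha>) y 1 = 0)"

text \<open>
  The count is \<open>enat\<close>-valued because \<open>card\<close> of an infinite set is \<open>0\<close>.
\<close>
definition num_real_eigenvalues :: "(real \<Rightarrow> real) \<Rightarrow> real \<Rightarrow> enat" where
  "num_real_eigenvalues q \<alpha> =
     (let E = {\<mu>::complex. \<mu> \<in> \<real> \<and> is_eigenvalue \<alpha> q \<mu>}
      in if finite E then enat (card E) else \<infinity>)"

end

theory Submission
  imports Defs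
begin

text \<open>
  Normalise \<open>c\<^sub>2 = 1\<close>. For \<open>\<alpha> > 1/2\<close> the integral equation is a Volterra equation with a bounded
  continuous kernel, so its solution \<open>y\<close> exists and depends continuously on kernel, potential and
  right-hand side. The eigenvalues are the zeros in \<open>\<lambda>\<close> of the boundary value
  \<open>F(\<alpha>, \<lambda>) = I\<^sup>1\<^sup>-\<^sup>\<alpha> y (1)\<close>, which is continuous in \<open>\<lambda>\<close> and, as \<open>\<alpha> \<rightarrow> 1\<close>, tends to \<open>y(1)\<close> for the
  classical Sturm-Liouville solution, because the kernels \<open>(1 - s)\<^sup>-\<^sup>\<alpha> / \<Gamma>(1 - \<alpha>)\<close> concentrate at
  \<open>s = 1\<close>. Variation of parameters gives \<open>y(1) = sin \<omega> / \<omega> + O(1 / \<omega>\<^sup>2)\<close> for \<open>\<lambda> = \<omega>\<^sup>2\<close>, so \<open>y(1)\<close>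
  alternates in sign along \<open>\<omega> = (k + 1/2) \<pi>\<close> for large \<open>k\<close>. For \<open>\<alpha>\<close> close to \<open>1\<close> any prescribed
  number of these sign changes persists, and each yields a zero of \<open>F(\<alpha>, \<cdot>)\<close>.
\<close>

section \<open>Volterra equations on the unit interval\<close>

text \<open>Continuity across 0 forces the kernel to start from the value 0. The power kernel
  \<open>u powr (2 * \<alpha> - 1)\<close> does so when \<alpha> > 1/2, which is where that
  restriction enters.\<close>

definition causal_kernel :: "real \<Rightarrow> (real \<Rightarrow> real) \<Rightarrow> bool" where
  "causal_kernel M K \<longleftrightarrow> continuous_on UNIV K \<and> (\<forall>u\<le>0. K u = 0) \<and> (\<forall>u. \<bar>K u\<bar> \<le> M)"

text \<open>The single inequality encodes both the bound C and the support in [0, 1]. It holds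
  everywhere rather than almost everywhere, so estimates can be made pointwise.\<close>

definition unit_density :: "real \<Rightarrow> (real \<Rightarrow> real) \<Rightarrow> bool" where
  "unit_density C r \<longleftrightarrow> r \<in> borel_measurable borel \<and> (\<forall>s. \<bar>r s\<bar> \<le> C * indicator {0..1} s)"

text \<open>
  Kernels vanish for negative arguments and densities outside \<open>[0, 1]\<close>, so the integral over the
  moving interval \<open>[0, t]\<close> becomes an integral over the whole line.
\<close>

definition volterra :: "(real \<Rightarrow> real) \<Rightarrow> (real \<Rightarrow> real) \<Rightarrow> (real \<Rightarrow> real) \<Rightarrow> real \<Rightarrow> real" where
  "volterra K r f t = (\<integral>s. K (t - s) * r s * f s \<partial>lborel)"

section \<open>Elementary properties of Volterra operators\<close>

lemma causal_kernelD:
  assumes "causal_kernel M K"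
  shows "continuous_on UNIV K" "u \<le> 0 \<Longrightarrow> K u = 0" "\<bar>K u\<bar> \<le> M" "0 \<le> M"
    "K \<in> borel_measurable borel"
proof -
  show "continuous_on UNIV K" "u \<le> 0 \<Longrightarrow> K u = 0" and *: "\<bar>K u\<bar> \<le> M" for u
    using assms by (auto simp: causal_kernel_def)
  show "0 \<le> M" using *[of 0] by linarith
  show "K \<in> borel_measurable borel"
    using assms by (auto simp: causal_kernel_def intro: borel_measurable_continuous_onI)
qed

lemma unit_densityD:
  assumes "unit_density C r"
  shows "r \<in> borel_measurable borel" "\<bar>r s\<bar> \<le> C * indicator {0..1} s" "\<bar>r s\<bar> \<le> C"
    "0 \<le> C" "s \<notin> {0..1} \<Longrightarrow> r s = 0"
proof -
  show "r \<in> borel_measurable borel" and *: "\<bar>r s\<bar> \<le> C * indicator {0..1} s" for s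
    using assms by (auto simp: unit_density_def)
  show C: "0 \<le> C" using *[of 0] by simp
  show "\<bar>r s\<bar> \<le> C" using *[of s] C by (cases "s \<in> {0..1}") auto
  show "s \<notin> {0..1} \<Longrightarrow> r s = 0" using *[of s] by simp
qed

lemma integrable_indicator_Icc_real [simp]:
  "integrable lborel (\<lambda>s. c * indicator {a..b::real} s :: real)"
  by (intro integrable_mult_right integrable_real_indicator) (auto simp: emeasure_lborel_Icc_eq)

lemma bounded_unit_interval:
  fixes f :: "real \<Rightarrow> real"
  assumes "continuous_on UNIV f"
  obtains B where "0 \<le> B" "\<And>s. s \<in> {0..1} \<Longrightarrow> \<bar>f s\<bar> \<le> B"
proof -
  have "compact (f ` {0..1})"
    using assms by (intro compact_continuous_image) (auto intro: continuous_on_subset)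
  then obtain B where B: "\<And>s. s \<in> {0..1} \<Longrightarrow> \<bar>f s\<bar> \<le> B"
    by (force simp: bounded_iff dest!: compact_imp_bounded)
  have "0 \<le> B" using B[of 0] by auto
  with B show ?thesis by (rule that[rotated])
qed

text \<open>Supplies a majorant that does not depend on u; it serves integrability, dominated
  convergence and the norm bound alike.\<close>

lemma volterra_integrand_bound:
  assumes K: "causal_kernel M K" and r: "unit_density C r"
    and f: "\<And>s. s \<in> {0..1} \<Longrightarrow> \<bar>f s\<bar> \<le> B"
  shows "\<bar>K u * r s * f s\<bar> \<le> M * C * B * indicator {0..1} s"
proof (cases "s \<in> {0..1}")
  case True
  then have "\<bar>K u\<bar> * \<bar>r s\<bar> * \<bar>f s\<bar> \<le> M * C * B"
    using f[OF True] causal_kernelD[OF K] unit_densityD[OF r] by (intro mult_mono) auto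
  with True show ?thesis by (simp add: abs_mult)
qed (use unit_densityD[OF r] in auto)

lemma volterra_integrable:
  assumes K: "causal_kernel M K" and r: "unit_density C r" and f: "continuous_on UNIV f"
  shows "integrable lborel (\<lambda>s. K (t - s) * r s * f s)"
proof -
  obtain B where B: "\<And>s. s \<in> {0..1} \<Longrightarrow> \<bar>f s\<bar> \<le> B"
    using bounded_unit_interval[OF f] by metis
  note [measurable] = causal_kernelD(5)[OF K] unit_densityD(1)[OF r]
    borel_measurable_continuous_onI[OF f]
  show ?thesis
  proof (rule Bochner_Integration.integrable_bound)
    show "integrable lborel (\<lambda>s. M * C * B * indicator {0..1::real} s :: real)" by simp
    show "AE s in lborel. norm (K (t - s) * r s * f s) \<le> norm (M * C * B * indicator {0..1} s)"
      using order_trans[OF volterra_integrand_bound[OF K r B] abs_ge_self]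
      by (intro AE_I2) (simp only: real_norm_def)
  qed measurable
qed

lemma volterra_continuous:
  assumes K: "causal_kernel M K" and r: "unit_density C r" and f: "continuous_on UNIV f"
  shows "continuous_on UNIV (volterra K r f)"
proof (rule continuous_on_sequentiallyI)
  fix x :: "nat \<Rightarrow> real" and a assume x: "x \<longlonglongrightarrow> a"
  obtain B where B: "\<And>s. s \<in> {0..1} \<Longrightarrow> \<bar>f s\<bar> \<le> B"
    using bounded_unit_interval[OF f] by metis
  note [measurable] = causal_kernelD(5)[OF K] unit_densityD(1)[OF r]
    borel_measurable_continuous_onI[OF f]
  show "(\<lambda>n. volterra K r f (x n)) \<longlonglongrightarrow> volterra K r f a"
    unfolding volterra_def
  proof (rule integral_dominated_convergence)
    show "integrable lborel (\<lambda>s. M * C * B * indicator {0..1::real} s :: real)" by simp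
    show "AE s in lborel. norm (K (x n - s) * r s * f s) \<le> M * C * B * indicator {0..1} s" for n
      using volterra_integrand_bound[OF K r B] by (intro AE_I2) auto
    have "(\<lambda>n. K (x n - s)) \<longlonglongrightarrow> K (a - s)" for s
      using causal_kernelD(1)[OF K] x
      by (intro continuous_on_tendsto_compose[of UNIV K] tendsto_intros) auto
    then show "AE s in lborel. (\<lambda>n. K (x n - s) * r s * f s) \<longlonglongrightarrow> K (a - s) * r s * f s"
      by (intro AE_I2 tendsto_intros)
  qed measurable
qed

lemma volterra_diff:
  assumes K: "causal_kernel M K" and r: "unit_density C r"
    and "continuous_on UNIV f" "continuous_on UNIV g"
  shows "volterra K r (\<lambda>s. f s - g s) t = volterra K r f t - volterra K r g t"
  unfolding volterra_def using assms
  by (simp add: volterra_integrable[OF K r] right_diff_distrib flip: Bochner_Integration.integral_diff)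

lemma volterra_add:
  assumes K: "causal_kernel M K" and r: "unit_density C r"
    and "continuous_on UNIV f" "continuous_on UNIV g"
  shows "volterra K r (\<lambda>s. f s + g s) t = volterra K r f t + volterra K r g t"
  unfolding volterra_def using assms
  by (simp add: volterra_integrable[OF K r] distrib_left flip: Bochner_Integration.integral_add)

lemma volterra_cong:
  assumes r: "unit_density C r" and "\<And>s. s \<in> {0..1} \<Longrightarrow> f s = g s"
  shows "volterra K r f t = volterra K r g t"
  unfolding volterra_def
proof (intro Bochner_Integration.integral_cong refl)
  show "K (t - s) * r s * f s = K (t - s) * r s * g s" for s
    using assms(2)[of s] unit_densityD(5)[OF r, of s] by (cases "s \<in> {0..1}") auto
qed

lemma volterra_bound:
  assumes K: "causal_kernel M K" and r: "unit_density C r" and f: "continuous_on UNIV f"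
    and B: "\<And>s. s \<in> {0..1} \<Longrightarrow> \<bar>f s\<bar> \<le> B"
  shows "\<bar>volterra K r f t\<bar> \<le> M * C * B"
proof -
  have "\<bar>volterra K r f t\<bar> \<le> (\<integral>s. \<bar>K (t - s) * r s * f s\<bar> \<partial>lborel)"
    unfolding volterra_def by (rule integral_abs_bound)
  also have "\<dots> \<le> (\<integral>s. M * C * B * indicator {0..1::real} s \<partial>lborel)"
    by (intro integral_mono integrable_abs volterra_integrable[OF K r f]
        volterra_integrand_bound[OF K r B]) auto
  finally show ?thesis by simp
qed

text \<open>Causality cuts the integral off at t, and integrating \<open>exp (L * s)\<close> over
  [0, t] gains a factor 1 / L. In the norm weighted by exp (- L t) the operator thus has norm at
  most M C / L, which is small for large L.\<close>

lemma volterra_exp_bound: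
  assumes K: "causal_kernel M K" and r: "unit_density C r" and f: "continuous_on UNIV f"
    and L: "0 < L" and S: "\<And>s. s \<in> {0..1} \<Longrightarrow> \<bar>f s\<bar> \<le> S * exp (L * s)" and t: "0 \<le> t"
  shows "\<bar>volterra K r f t\<bar> \<le> M * C / L * S * exp (L * t)"
proof -
  note Kd = causal_kernelD[OF K] and rd = unit_densityD[OF r]
  have S0: "0 \<le> S" using S[of 0] by simp
  have ex: "((\<lambda>x. exp (L * x) / L) has_real_derivative exp (L * x)) (at x)" for x
    using L by (auto intro!: derivative_eq_intros)
  have int: "(\<integral>s. exp (L * s) * indicator {0..t} s \<partial>lborel) = exp (L * t) / L - exp (L * 0) / L"
    by (rule integral_FTC_Icc_nonneg[where F = "\<lambda>x. exp (L * x) / L"]) (use ex t in auto)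
  have ib: "integrable lborel (\<lambda>s. exp (L * s) * indicator {0..t} s)"
    by (rule integrable_FTC_Icc_nonneg[where F = "\<lambda>x. exp (L * x) / L"]) (use ex t in auto)
  have "\<bar>volterra K r f t\<bar> \<le> (\<integral>s. \<bar>K (t - s) * r s * f s\<bar> \<partial>lborel)"
    unfolding volterra_def by (rule integral_abs_bound)
  also have "\<dots> \<le> (\<integral>s. M * C * S * (exp (L * s) * indicator {0..t} s) \<partial>lborel)"
  proof (intro integral_mono integrable_abs volterra_integrable[OF K r f] integrable_mult_right ib)
    fix s :: real
    show "\<bar>K (t - s) * r s * f s\<bar> \<le> M * C * S * (exp (L * s) * indicator {0..t} s)"
    proof (cases "s \<in> {0..1} \<and> s \<le> t")
      case True
      then have "\<bar>K (t - s)\<bar> * \<bar>r s\<bar> * \<bar>f s\<bar> \<le> M * C * (S * exp (L * s))"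
        using S[of s] Kd rd S0 by (intro mult_mono) auto
      with True show ?thesis by (simp add: abs_mult mult_ac)
    next
      case False
      \<comment> \<open>Beyond t the kernel vanishes, outside [0, 1] the density does.\<close>
      then have "K (t - s) * r s = 0" using Kd(2)[of "t - s"] rd(5)[of s] by auto
      then show ?thesis using Kd(4) rd(4) S0 by (auto simp: indicator_def)
    qed
  qed
  also have "\<dots> = M * C * S * (exp (L * t) / L - 1 / L)" using int by simp
  also have "\<dots> \<le> M * C * S * (exp (L * t) / L)"
    using Kd(4) rd(4) S0 L by (intro mult_left_mono) auto
  finally show ?thesis by simp
qed

text \<open>A substitute for Gronwall's inequality: in the weighted norm the Volterra term is at
  most half of y, so it is absorbed on the left. The factor 2 comes from the absorption,
  \<open>exp L\<close> from removing the weight.\<close>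

lemma volterra_stability:
  assumes K: "causal_kernel M K" and r: "unit_density C r" and y: "continuous_on UNIV y"
    and L: "0 < L" "2 * M * C \<le> L"
    and le: "\<And>t. t \<in> {0..1} \<Longrightarrow> \<bar>y t - volterra K r y t\<bar> \<le> e"
    and t: "t \<in> {0..1}"
  shows "\<bar>y t\<bar> \<le> 2 * e * exp L"
proof -
  have e: "0 \<le> e" using le[of 0] by auto
  have "continuous_on {0..1} (\<lambda>s. \<bar>y s\<bar> * exp (- L * s))"
    using continuous_on_subset[OF y] by (intro continuous_intros) auto
  then obtain m where m: "m \<in> {0..1}"
    and max: "\<And>s. s \<in> {0..1} \<Longrightarrow> \<bar>y s\<bar> * exp (- L * s) \<le> \<bar>y m\<bar> * exp (- L * m)"
    using continuous_attains_sup[of "{0..1::real}" "\<lambda>s. \<bar>y s\<bar> * exp (- L * s)"] by auto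
  \<comment> \<open>S is the weighted sup norm of y, attained at m.\<close>
  define S where "S = \<bar>y m\<bar> * exp (- L * m)"
  have bound: "\<bar>y s\<bar> \<le> S * exp (L * s)" if "s \<in> {0..1}" for s
    using max[OF that] by (simp add: S_def exp_minus field_simps)
  have S0: "0 \<le> S" by (simp add: S_def)
  have ym: "\<bar>y m\<bar> = S * exp (L * m)" by (simp add: S_def exp_minus)
  have "\<bar>volterra K r y m\<bar> \<le> M * C / L * S * exp (L * m)"
    using volterra_exp_bound[OF K r y L(1) bound] m by auto
  also have "\<dots> \<le> 1 / 2 * S * exp (L * m)"
    using L S0 by (intro mult_right_mono) (auto simp: field_simps)
  finally have "S * exp (L * m) \<le> e + 1 / 2 * S * exp (L * m)"
    using le[OF m] ym by linarith
  then have *: "S * exp (L * m) \<le> 2 * e" by linarith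
  have "S * 1 \<le> S * exp (L * m)" using S0 L m by (intro mult_left_mono) auto
  with * have "S \<le> 2 * e" by simp
  then have "S * exp (L * t) \<le> 2 * e * exp L"
    using S0 e L t by (intro mult_mono) (auto simp: mult_left_le)
  with bound[OF t] show ?thesis by linarith
qed

section \<open>Existence of solutions by Banach's fixed point theorem\<close>

definition clamp01 :: "real \<Rightarrow> real" where "clamp01 u = max 0 (min 1 u)"

lemma clamp01: "clamp01 u \<in> {0..1}" "u \<in> {0..1} \<Longrightarrow> clamp01 u = u" "u \<le> 0 \<Longrightarrow> clamp01 u = 0"
  "0 \<le> clamp01 u" "clamp01 u \<le> 1" "\<bar>clamp01 u - clamp01 v\<bar> \<le> \<bar>u - v\<bar>"
  by (auto simp: clamp01_def)

lemma continuous_on_clamp01 [continuous_intros]: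
  "continuous_on A f \<Longrightarrow> continuous_on A (\<lambda>x. clamp01 (f x))"
  unfolding clamp01_def by (intro continuous_intros)

text \<open>The weight \<open>exp (- L t)\<close> turns the Volterra operator into a contraction.\<close>

lemma volterra_solution_exists:
  assumes K: "causal_kernel M K" and r: "unit_density C r" and p: "continuous_on UNIV p"
  obtains y where "continuous_on UNIV y" "\<And>t. t \<in> {0..1} \<Longrightarrow> y t = p t + volterra K r y t"
proof -
  \<comment> \<open>The factor 2 gives the contraction constant 1/2; the summand 1 keeps L positive
    when M C = 0.\<close>
  define L where "L = 2 * M * C + 1"
  have MC: "0 \<le> M * C" using causal_kernelD(4)[OF K] unit_densityD(4)[OF r] by simp
  have L: "0 < L" "M * C / L \<le> 1 / 2" using MC by (auto simp: L_def field_simps)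
  \<comment> \<open>The fixed point z is the weighted unknown and \<open>W z\<close> removes the
    weight, so the plain sup metric on z is the weighted metric on solutions.\<close>
  define W where "W z s = exp (L * s) * apply_bcontfun z s" for z and s :: real
  \<comment> \<open>Clamping the argument makes \<open>G z\<close> constant on either side of
    [0, 1], hence bounded, so that it is again a bounded continuous function.\<close>
  define G where "G z t = exp (- L * clamp01 t) * (p (clamp01 t) + volterra K r (W z) (clamp01 t))"
    for z and t :: real
  have W: "continuous_on UNIV (W z)" for z
    unfolding W_def by (intro continuous_intros) auto
  have comp: "continuous_on UNIV (\<lambda>t. g (clamp01 t))" if "continuous_on UNIV g" for g :: "real \<Rightarrow> real"
    by (rule continuous_on_compose2[OF that]) (auto intro: continuous_intros)
  have Gc: "continuous_on UNIV (G z)" for z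
    unfolding G_def
    by (intro continuous_intros comp p volterra_continuous[OF K r W])
  have Gb: "G z \<in> bcontfun" for z
  proof -
    obtain B where "0 \<le> B" and B: "\<And>s. s \<in> {0..1} \<Longrightarrow> \<bar>G z s\<bar> \<le> B"
      using bounded_unit_interval[OF Gc] by blast
    have "G z t = G z (clamp01 t)" for t by (simp add: G_def clamp01)
    then have "norm (G z t) \<le> B" for t using B[of "clamp01 t"] clamp01(1)[of t] by simp
    then show ?thesis by (intro bcontfun_normI[OF Gc])
  qed
  have "\<exists>!z. Bcontfun (G z) = z"
  proof (rule banach_fix_type[where c = "1/2"]; (intro allI)?)
    fix z1 z2 :: "real \<Rightarrow>\<^sub>C real"
    show "dist (Bcontfun (G z1)) (Bcontfun (G z2)) \<le> 1/2 * dist z1 z2"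
    proof (rule dist_bound)
      fix t
      let ?c = "clamp01 t"
      have "\<bar>volterra K r (\<lambda>s. W z1 s - W z2 s) ?c\<bar> \<le> M * C / L * dist z1 z2 * exp (L * ?c)"
      proof (rule volterra_exp_bound[OF K r _ L(1)])
        show "continuous_on UNIV (\<lambda>s. W z1 s - W z2 s)" by (intro continuous_intros W)
        show "\<bar>W z1 s - W z2 s\<bar> \<le> dist z1 z2 * exp (L * s)" for s
          using dist_bounded[of z1 s z2]
          by (simp add: W_def dist_real_def abs_mult flip: right_diff_distrib)
      qed (simp add: clamp01)
      also have "\<dots> \<le> 1/2 * dist z1 z2 * exp (L * ?c)"
        using L by (intro mult_right_mono) auto
      finally have "exp (- L * ?c) * \<bar>volterra K r (\<lambda>s. W z1 s - W z2 s) ?c\<bar>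
          \<le> exp (- L * ?c) * (1/2 * dist z1 z2 * exp (L * ?c))"
        by (intro mult_left_mono) auto
      also have "\<dots> = 1/2 * dist z1 z2" by (simp add: exp_minus field_simps)
      also have "exp (- L * ?c) * \<bar>volterra K r (\<lambda>s. W z1 s - W z2 s) ?c\<bar> = \<bar>G z1 t - G z2 t\<bar>"
        by (simp add: G_def volterra_diff[OF K r W W] abs_mult flip: right_diff_distrib)
      finally show "dist (apply_bcontfun (Bcontfun (G z1)) t) (apply_bcontfun (Bcontfun (G z2)) t)
          \<le> 1/2 * dist z1 z2"
        by (simp add: Bcontfun_inverse[OF Gb] dist_real_def)
    qed
  qed auto
  then obtain z where "Bcontfun (G z) = z" by blast
  then have z: "apply_bcontfun z t = G z t" for t
    using Bcontfun_inverse[OF Gb, of z] by metis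
  have "W z t = p t + volterra K r (W z) t" if "t \<in> {0..1}" for t
    unfolding W_def[of z t] z G_def using that by (simp add: clamp01 exp_minus)
  then show ?thesis using W that by blast
qed

section \<open>Perturbation of the kernel, the density and the solution\<close>

lemma volterra_kernel_diff:
  assumes K: "causal_kernel M K" and K': "causal_kernel M' K'"
    and D: "\<And>u. \<bar>K u - K' u\<bar> \<le> D"
    and r: "unit_density C r" and f: "continuous_on UNIV f"
    and B: "\<And>s. s \<in> {0..1} \<Longrightarrow> \<bar>f s\<bar> \<le> B"
  shows "\<bar>volterra K r f t - volterra K' r f t\<bar> \<le> D * C * B"
proof -
  have "causal_kernel D (\<lambda>u. K u - K' u)"
    using K K' D by (auto simp: causal_kernel_def intro: continuous_intros)
  moreover have "volterra K r f t - volterra K' r f t = volterra (\<lambda>u. K u - K' u) r f t"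
    unfolding volterra_def
    by (simp add: volterra_integrable[OF K r f] volterra_integrable[OF K' r f] left_diff_distrib
        flip: Bochner_Integration.integral_diff)
  ultimately show ?thesis using volterra_bound[OF _ r f B] by simp
qed

lemma volterra_density_diff:
  assumes K: "causal_kernel M K" and r: "unit_density C r" and r': "unit_density C' r'"
    and D: "\<And>s. s \<in> {0..1} \<Longrightarrow> \<bar>r s - r' s\<bar> \<le> D" and f: "continuous_on UNIV f"
    and B: "\<And>s. s \<in> {0..1} \<Longrightarrow> \<bar>f s\<bar> \<le> B"
  shows "\<bar>volterra K r f t - volterra K r' f t\<bar> \<le> M * D * B"
proof -
  have "\<bar>r s - r' s\<bar> \<le> D * indicator {0..1} s" for s
    using D[of s] unit_densityD(5)[OF r, of s] unit_densityD(5)[OF r', of s]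
    by (cases "s \<in> {0..1}") auto
  then have "unit_density D (\<lambda>s. r s - r' s)"
    using unit_densityD(1)[OF r] unit_densityD(1)[OF r'] by (auto simp: unit_density_def)
  moreover have "volterra K r f t - volterra K r' f t = volterra K (\<lambda>s. r s - r' s) f t"
    unfolding volterra_def
    by (simp add: volterra_integrable[OF K r f] volterra_integrable[OF K r' f]
        left_diff_distrib right_diff_distrib flip: Bochner_Integration.integral_diff)
  ultimately show ?thesis using volterra_bound[OF K _ f B] by simp
qed

text \<open>Here z solves the equation of y only up to a residual e. By linearity y - z satisfies
  the homogeneous equation up to e, and stability applies. Below, z is the solution of a nearby
  equation.\<close>

lemma volterra_compare:
  assumes K: "causal_kernel M K" and r: "unit_density C r"
    and y: "continuous_on UNIV y" and z: "continuous_on UNIV z"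
    and L: "0 < L" "2 * M * C \<le> L"
    and ys: "\<And>t. t \<in> {0..1} \<Longrightarrow> y t = p t + volterra K r y t"
    and zs: "\<And>t. t \<in> {0..1} \<Longrightarrow> \<bar>p t + volterra K r z t - z t\<bar> \<le> e"
    and t: "t \<in> {0..1}"
  shows "\<bar>y t - z t\<bar> \<le> 2 * e * exp L"
proof (rule volterra_stability[OF K r _ L _ t])
  show "continuous_on UNIV (\<lambda>t. y t - z t)" using y z by (intro continuous_intros)
  show "\<bar>(y t - z t) - volterra K r (\<lambda>t. y t - z t) t\<bar> \<le> e" if "t \<in> {0..1}" for t
    using ys[OF that] zs[OF that] by (simp add: volterra_diff[OF K r y z] algebra_simps)
qed

section \<open>The fractional problem\<close>

text \<open>For 0 \<le> s \<le> t \<le> 1 the argument t - s lies in [0, 1], so clamping leaves the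
  kernel of the Riemann-Liouville integral of order 2 \<alpha> unchanged there and makes it bounded
  and causal on the whole line.\<close>

definition frac_kernel :: "real \<Rightarrow> real \<Rightarrow> real" where
  "frac_kernel \<alpha> u = clamp01 u powr (2 * \<alpha> - 1) / Gamma (2 * \<alpha>)"

definition frac_start :: "real \<Rightarrow> real \<Rightarrow> real" where
  "frac_start \<alpha> t = clamp01 t powr \<alpha> / Gamma (\<alpha> + 1)"

text \<open>The real integral equation with \<open>c\<^sub>2 = 1\<close>. At \<alpha> = 1 it is the
  integrated form of y'' = r y, y(0) = 0, y'(0) = 1.\<close>

definition frac_solution :: "real \<Rightarrow> (real \<Rightarrow> real) \<Rightarrow> (real \<Rightarrow> real) \<Rightarrow> bool" where
  "frac_solution \<alpha> r y \<longleftrightarrow> continuous_on UNIV y \<and>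
     (\<forall>t\<in>{0..1}. y t = frac_start \<alpha> t + volterra (frac_kernel \<alpha>) r y t)"

text \<open>The Riemann-Liouville integral of order 1 - \<alpha> at the endpoint 1.\<close>

definition frac_trace :: "real \<Rightarrow> (real \<Rightarrow> real) \<Rightarrow> real" where
  "frac_trace \<alpha> y =
     1 / Gamma (1 - \<alpha>) * (\<integral>s. indicator {0..1} s * (1 - s) powr (- \<alpha>) * y s \<partial>lborel)"

lemma Gamma_real_neq_0: "0 < x \<Longrightarrow> Gamma x \<noteq> (0::real)"
  using Gamma_real_pos[of x] by linarith

lemma continuous_on_clamp01_powr:
  assumes "0 < b"
  shows "continuous_on UNIV (\<lambda>u. clamp01 u powr b)"
  using assms by (intro continuous_on_powr' continuous_intros) (auto simp: clamp01)

lemma clamp01_powr_le_1: "0 \<le> b \<Longrightarrow> clamp01 u powr b \<le> 1"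
  using powr_mono2[of b "clamp01 u" 1] by (simp add: clamp01)

lemma causal_frac_kernel:
  assumes "1/2 < \<alpha>"
  shows "causal_kernel (1 / Gamma (2 * \<alpha>)) (frac_kernel \<alpha>)"
  unfolding causal_kernel_def frac_kernel_def
proof (intro conjI allI impI)
  have G: "Gamma (2 * \<alpha>) > 0" using assms by (intro Gamma_real_pos) auto
  show "continuous_on UNIV (\<lambda>u. clamp01 u powr (2 * \<alpha> - 1) / Gamma (2 * \<alpha>))"
    using assms
    by (intro continuous_on_divide continuous_on_const continuous_on_clamp01_powr)
      (auto simp: Gamma_real_neq_0)
  show "u \<le> 0 \<Longrightarrow> clamp01 u powr (2 * \<alpha> - 1) / Gamma (2 * \<alpha>) = 0" for u
    by (simp add: clamp01)
  show "\<bar>clamp01 u powr (2 * \<alpha> - 1) / Gamma (2 * \<alpha>)\<bar> \<le> 1 / Gamma (2 * \<alpha>)" for u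
    using clamp01_powr_le_1[of "2 * \<alpha> - 1" u] assms G by (simp add: divide_right_mono)
qed

lemma continuous_frac_start: "0 < \<alpha> \<Longrightarrow> continuous_on UNIV (frac_start \<alpha>)"
  unfolding frac_start_def
  by (intro continuous_on_divide continuous_on_const continuous_on_clamp01_powr)
    (auto simp: Gamma_real_neq_0)

lemma frac_solution_exists:
  assumes "1/2 < \<alpha>" "unit_density C r"
  obtains y where "frac_solution \<alpha> r y"
proof -
  have "continuous_on UNIV (frac_start \<alpha>)" using assms by (intro continuous_frac_start) auto
  from volterra_solution_exists[OF causal_frac_kernel[OF assms(1)] assms(2) this] that show ?thesis
    unfolding frac_solution_def by metis
qed

text \<open>By Young's inequality, \<open>u\<^sup>b \<le> b u + (1 - b)\<close>.\<close>

lemma powr_minus_self_le: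
  fixes u b :: real
  assumes "0 \<le> u" "u \<le> 1" "0 \<le> b" "b \<le> 1"
  shows "\<bar>u powr b - u\<bar> \<le> 1 - b"
proof (cases "u = 0")
  case False
  then have u: "0 < u" using assms by simp
  have "u powr b * 1 powr (1 - b) \<le> b * u + (1 - b) * 1"
    using assms u by (intro Youngs_inequality_0) auto
  then have "u powr b - u \<le> (1 - b) * (1 - u)" by (simp add: algebra_simps)
  also have "\<dots> \<le> (1 - b) * 1" using assms by (intro mult_left_mono) auto
  finally have "u powr b - u \<le> 1 - b" by simp
  moreover have "u powr 1 \<le> u powr b" using assms by (intro powr_mono') auto
  ultimately show ?thesis using u by simp
qed (use assms in auto)

text \<open>One estimate for both the kernel (b = 2 \<alpha> - 1) and the starting term (b =
  \<alpha>). The first summand is the error of the exponent, the second that of the Gamma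
  factor.\<close>

lemma clamp01_powr_scaled_diff:
  assumes "0 \<le> b" "b \<le> 1" "0 < G"
  shows "\<bar>clamp01 u powr b / G - clamp01 u\<bar> \<le> (1 - b) / G + \<bar>1 / G - 1\<bar>"
proof -
  have "\<bar>clamp01 u powr b / G - clamp01 u\<bar>
      = \<bar>(clamp01 u powr b - clamp01 u) / G + clamp01 u * (1 / G - 1)\<bar>"
    by (simp add: field_simps diff_divide_distrib)
  also have "\<dots> \<le> \<bar>clamp01 u powr b - clamp01 u\<bar> / G + clamp01 u * \<bar>1 / G - 1\<bar>"
    using assms clamp01(4)[of u] by (intro order_trans[OF abs_triangle_ineq]) (simp add: abs_mult)
  also have "\<dots> \<le> (1 - b) / G + 1 * \<bar>1 / G - 1\<bar>"
    using powr_minus_self_le[of "clamp01 u" b] assms clamp01(4,5)[of u]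
    by (intro add_mono divide_right_mono mult_right_mono) auto
  finally show ?thesis by simp
qed

lemma frac_kernel_1: "frac_kernel 1 u = clamp01 u"
  using Gamma_numeral[of "num.Bit0 num.One", where 'a = real] by (simp add: frac_kernel_def clamp01)

lemma frac_start_1: "frac_start 1 t = clamp01 t"
  using Gamma_numeral[of "num.Bit0 num.One", where 'a = real] by (simp add: frac_start_def clamp01)

section \<open>The boundary value and its limit as \<alpha> tends to 1\<close>

lemma trace_weight_integral:
  fixes \<alpha> :: real
  assumes "\<alpha> < 1"
  shows "has_bochner_integral lborel (\<lambda>s. indicator {0..1} s * (1 - s) powr (- \<alpha>)) (1 / (1 - \<alpha>))"
proof -
  let ?g = "\<lambda>s::real. indicator {0..1} s * s powr (- \<alpha>)"
  have "((\<lambda>x::real. x powr (- \<alpha>)) has_integral (1 powr (- \<alpha> + 1) / (- \<alpha> + 1))) {0..1}"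
    using assms by (intro has_integral_powr_from_0) auto
  then have "(\<integral>\<^sup>+s. ennreal (?g s) \<partial>lborel) = ennreal (1 / (1 - \<alpha>))"
    by (subst nn_integral_has_integral_lebesgue[where I = "1 / (1 - \<alpha>)"]) auto
  then have "has_bochner_integral lborel ?g (1 / (1 - \<alpha>))"
    using assms by (intro has_bochner_integral_nn_integral) auto
  \<comment> \<open>The reflection of s to 1 - s moves the singularity from 0 to 1.\<close>
  then have "has_bochner_integral lborel (\<lambda>s. ?g (1 + (-1) * s)) ((1 / (1 - \<alpha>)) /\<^sub>R \<bar>-1\<bar>)"
    by (subst (asm) lborel_has_bochner_integral_real_affine_iff[where c = "-1" and t = 1]) auto
  moreover have "(\<lambda>s. ?g (1 + (-1) * s)) = (\<lambda>s. indicator {0..1} s * (1 - s) powr (- \<alpha>))"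
    by (auto simp: indicator_def)
  ultimately show ?thesis by simp
qed

lemma trace_integrable:
  fixes y :: "real \<Rightarrow> real"
  assumes \<alpha>: "\<alpha> < 1" and y: "continuous_on UNIV y"
  shows "integrable lborel (\<lambda>s. indicator {0..1} s * (1 - s) powr (- \<alpha>) * y s)"
proof -
  obtain B where "0 \<le> B" and B: "\<And>s. s \<in> {0..1} \<Longrightarrow> \<bar>y s\<bar> \<le> B"
    using bounded_unit_interval[OF y] by metis
  note [measurable] = borel_measurable_continuous_onI[OF y]
  show ?thesis
  proof (rule Bochner_Integration.integrable_bound)
    show "integrable lborel (\<lambda>s. B * (indicator {0..1} s * (1 - s) powr (- \<alpha>)))"
      using trace_weight_integral[OF \<alpha>] by (simp add: has_bochner_integral_iff)
    have "norm (indicator {0..1} s * (1 - s) powr (- \<alpha>) * y s)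
        \<le> norm (B * (indicator {0..1} s * (1 - s) powr (- \<alpha>)))" for s
      using B[of s] \<open>0 \<le> B\<close>
      by (auto simp: indicator_def abs_mult mult.commute[of B] intro!: mult_left_mono)
    then show "AE s in lborel. norm (indicator {0..1} s * (1 - s) powr (- \<alpha>) * y s)
        \<le> norm (B * (indicator {0..1} s * (1 - s) powr (- \<alpha>)))" by simp
  qed measurable
qed

text \<open>The factor 1 - \<alpha> cancels the weight integral 1 / (1 - \<alpha>), so the
  normalised weight has total mass \<open>1 / Gamma (2 - \<alpha>)\<close>.\<close>

lemma inverse_Gamma_1_minus:
  assumes "\<alpha> < (1::real)"
  shows "1 / Gamma (1 - \<alpha>) = (1 - \<alpha>) / Gamma (2 - \<alpha>)"
proof -
  have "1 - \<alpha> \<notin> \<int>\<^sub>\<le>\<^sub>0" using nonpos_Ints_nonpos[of "1 - \<alpha>"] assms by linarith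
  from Gamma_plus1[OF this] have "Gamma (2 - \<alpha>) = (1 - \<alpha>) * Gamma (1 - \<alpha>)" by simp
  then show ?thesis using assms by simp
qed

text \<open>
  The factor \<open>(1 - s)\<^sup>\<alpha>\<close> cancels the singularity of the weight, and \<open>1 / \<Gamma>(1 - \<alpha>)\<close> is
  \<open>(1 - \<alpha>) / \<Gamma>(2 - \<alpha>)\<close>; this makes the \<open>\<Lambda>\<close>-term vanish as \<open>\<alpha> \<rightarrow> 1\<close>.
\<close>

lemma frac_trace_approx:
  assumes \<alpha>: "\<alpha> < 1" and y: "continuous_on UNIV y"
    and le: "\<And>s::real. s \<in> {0..1} \<Longrightarrow> \<bar>y s - c\<bar> \<le> D + \<Lambda> * (1 - s) powr \<alpha>" and \<Lambda>: "0 \<le> \<Lambda>"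
  shows "\<bar>frac_trace \<alpha> y - c / Gamma (2 - \<alpha>)\<bar> \<le> (D + \<Lambda> * (1 - \<alpha>)) / Gamma (2 - \<alpha>)"
proof -
  let ?w = "\<lambda>s. indicator {0..1} s * (1 - s) powr (- \<alpha>)"
  \<comment> \<open>The left side is the trace of the constant function c, so only the trace of y -
    c has to be estimated.\<close>
  have c: "c / Gamma (2 - \<alpha>) = (1 - \<alpha>) / Gamma (2 - \<alpha>) * (c * (1 / (1 - \<alpha>)))"
    using \<alpha> by simp
  have w: "integrable lborel ?w" "(\<integral>s. ?w s \<partial>lborel) = 1 / (1 - \<alpha>)"
    using trace_weight_integral[OF \<alpha>] by (auto simp: has_bochner_integral_iff)
  have i: "integrable lborel (\<lambda>s. ?w s * (y s - c))"
    using trace_integrable[OF \<alpha>, of "\<lambda>s. y s - c"] y by (simp add: continuous_intros)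
  have "(\<integral>s. ?w s * (y s - c) \<partial>lborel) = (\<integral>s. ?w s * y s - c * ?w s \<partial>lborel)"
    by (intro Bochner_Integration.integral_cong) (auto simp: algebra_simps)
  also have "\<dots> = (\<integral>s. ?w s * y s \<partial>lborel) - c * (1 / (1 - \<alpha>))"
    using trace_integrable[OF \<alpha> y] w by (subst Bochner_Integration.integral_diff) auto
  finally have *: "(\<integral>s. ?w s * (y s - c) \<partial>lborel)
      = (\<integral>s. ?w s * y s \<partial>lborel) - c * (1 / (1 - \<alpha>))" .
  have eq: "frac_trace \<alpha> y - c / Gamma (2 - \<alpha>)
      = (1 - \<alpha>) / Gamma (2 - \<alpha>) * (\<integral>s. ?w s * (y s - c) \<partial>lborel)"
    unfolding frac_trace_def inverse_Gamma_1_minus[OF \<alpha>] * c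
    by (rule right_diff_distrib[symmetric])
  have "\<bar>\<integral>s. ?w s * (y s - c) \<partial>lborel\<bar> \<le> (\<integral>s. \<bar>?w s * (y s - c)\<bar> \<partial>lborel)"
    by (rule integral_abs_bound)
  also have "\<dots> \<le> (\<integral>s. D * ?w s + \<Lambda> * indicator {0..1} s \<partial>lborel)"
  proof (intro integral_mono integrable_abs i)
    show "integrable lborel (\<lambda>s. D * ?w s + \<Lambda> * indicator {0..1} s)"
      using w by auto
    show "\<bar>?w s * (y s - c)\<bar> \<le> D * ?w s + \<Lambda> * indicator {0..1} s" for s
    proof (cases "s \<in> {0..1}")
      case True
      \<comment> \<open>Only an inequality, because at s = 1 both powers have base 0 and the product
        is 0.\<close>
      have "(1 - s) powr (- \<alpha>) * (1 - s) powr \<alpha> \<le> 1"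
        by (simp add: powr_minus field_simps)
      then have "\<Lambda> * ((1 - s) powr (- \<alpha>) * (1 - s) powr \<alpha>) \<le> \<Lambda>"
        using \<Lambda> by (rule mult_left_le)
      moreover have "(1 - s) powr (- \<alpha>) * \<bar>y s - c\<bar>
          \<le> (1 - s) powr (- \<alpha>) * (D + \<Lambda> * (1 - s) powr \<alpha>)"
        using le[OF True] by (intro mult_left_mono) auto
      ultimately have "(1 - s) powr (- \<alpha>) * \<bar>y s - c\<bar> \<le> D * (1 - s) powr (- \<alpha>) + \<Lambda>"
        by (simp add: algebra_simps)
      then show ?thesis using True by (simp add: abs_mult)
    qed auto
  qed
  also have "\<dots> = D / (1 - \<alpha>) + \<Lambda>" using w by (subst Bochner_Integration.integral_add) auto
  finally have "(1 - \<alpha>) / Gamma (2 - \<alpha>) * \<bar>\<integral>s. ?w s * (y s - c) \<partial>lborel\<bar>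
      \<le> (1 - \<alpha>) / Gamma (2 - \<alpha>) * (D / (1 - \<alpha>) + \<Lambda>)"
    using \<alpha> by (intro mult_left_mono) auto
  also have "\<dots> = (D + \<Lambda> * (1 - \<alpha>)) / Gamma (2 - \<alpha>)"
    using \<alpha> by (simp add: distrib_left add_divide_distrib mult.commute)
  finally show ?thesis unfolding eq abs_mult using \<alpha> by simp
qed

text \<open>The starting term has slope 1, and the kernel \<open>clamp01\<close> is 1-Lipschitz,
  which gives the integral term the constant C B. This is the decay at s = 1 that
  \<open>frac_trace_approx\<close> asks for.\<close>

lemma classical_solution_lipschitz:
  assumes r: "unit_density C r" and y: "frac_solution 1 r y"
  obtains \<Lambda> where "0 \<le> \<Lambda>" "\<And>s. s \<in> {0..1} \<Longrightarrow> \<bar>y s - y 1\<bar> \<le> \<Lambda> * (1 - s)"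
proof -
  have yc: "continuous_on UNIV y" using y by (simp add: frac_solution_def)
  have K: "causal_kernel (1 / Gamma (2 * 1)) (frac_kernel 1)" by (rule causal_frac_kernel) simp
  obtain B where "0 \<le> B" and B: "\<And>s. s \<in> {0..1} \<Longrightarrow> \<bar>y s\<bar> \<le> B"
    using bounded_unit_interval[OF yc] by metis
  show ?thesis
  proof (rule that[of "1 + C * B"])
    show "0 \<le> 1 + C * B" using \<open>0 \<le> B\<close> unit_densityD(4)[OF r] by simp
    fix s :: real assume s: "s \<in> {0..1}"
    note int = volterra_integrable[OF K r yc]
    let ?d = "\<lambda>\<tau>. frac_kernel 1 (s - \<tau>) * r \<tau> * y \<tau> - frac_kernel 1 (1 - \<tau>) * r \<tau> * y \<tau>"
    have "\<bar>volterra (frac_kernel 1) r y s - volterra (frac_kernel 1) r y 1\<bar> = \<bar>\<integral>\<tau>. ?d \<tau> \<partial>lborel\<bar>"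
      unfolding volterra_def by (simp add: int)
    also have "\<dots> \<le> (\<integral>\<tau>. \<bar>?d \<tau>\<bar> \<partial>lborel)" by (rule integral_abs_bound)
    also have "\<dots> \<le> (\<integral>\<tau>. (1 - s) * C * B * indicator {0..1::real} \<tau> \<partial>lborel)"
    proof (intro integral_mono integrable_abs Bochner_Integration.integrable_diff int)
      show "\<bar>?d \<tau>\<bar> \<le> (1 - s) * C * B * indicator {0..1} \<tau>" for \<tau>
      proof (cases "\<tau> \<in> {0..1}")
        case True
        have "\<bar>clamp01 (s - \<tau>) - clamp01 (1 - \<tau>)\<bar> \<le> 1 - s"
          using clamp01(6)[of "s - \<tau>" "1 - \<tau>"] s by simp
        then have "\<bar>clamp01 (s - \<tau>) - clamp01 (1 - \<tau>)\<bar> * \<bar>r \<tau>\<bar> * \<bar>y \<tau>\<bar> \<le> (1 - s) * C * B"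
          using B[OF True] unit_densityD(3,4)[OF r] s by (intro mult_mono) auto
        then show ?thesis using True
          by (simp add: frac_kernel_1 abs_mult flip: left_diff_distrib)
      qed (use unit_densityD(5)[OF r] in auto)
    qed auto
    also have "\<dots> = (1 - s) * C * B" by simp
    finally have "\<bar>volterra (frac_kernel 1) r y s - volterra (frac_kernel 1) r y 1\<bar> \<le> (1 - s) * C * B" .
    moreover have "y s - y 1 = (s - 1) + (volterra (frac_kernel 1) r y s - volterra (frac_kernel 1) r y 1)"
      using y s by (simp add: frac_solution_def frac_start_1 clamp01)
    ultimately have "\<bar>y s - y 1\<bar> \<le> (1 - s) + (1 - s) * C * B" using s by auto
    then show "\<bar>y s - y 1\<bar> \<le> (1 + C * B) * (1 - s)" by (simp add: algebra_simps)
  qed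
qed

text \<open>\<open>y1\<close> solves the \<alpha>-equation up to a small residual, so
  \<open>y \<alpha>\<close> is uniformly close to it, and \<open>y1\<close> is Lipschitz at 1. Both
  errors feed \<open>frac_trace_approx\<close> with c = \<open>y1 1\<close>.\<close>

lemma frac_trace_tendsto:
  assumes r: "unit_density C r" and y1: "frac_solution 1 r y1"
    and y: "\<And>\<alpha>. \<alpha> \<in> {1/2<..<1} \<Longrightarrow> frac_solution \<alpha> r (y \<alpha>)"
  shows "((\<lambda>\<alpha>. frac_trace \<alpha> (y \<alpha>)) \<longlongrightarrow> y1 1) (at 1 within {1/2<..<1})"
proof -
  let ?F = "at 1 within {1/2<..<1::real}"
  have y1c: "continuous_on UNIV y1"
    and y1s: "\<And>t. t \<in> {0..1} \<Longrightarrow> y1 t = frac_start 1 t + volterra (frac_kernel 1) r y1 t"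
    using y1 by (auto simp: frac_solution_def)
  have C: "0 \<le> C" using unit_densityD(4)[OF r] .
  obtain B where B0: "0 \<le> B" and B: "\<And>s. s \<in> {0..1} \<Longrightarrow> \<bar>y1 s\<bar> \<le> B"
    using bounded_unit_interval[OF y1c] by metis
  obtain \<Lambda> where \<Lambda>0: "0 \<le> \<Lambda>" and \<Lambda>: "\<And>s. s \<in> {0..1} \<Longrightarrow> \<bar>y1 s - y1 1\<bar> \<le> \<Lambda> * (1 - s)"
    using classical_solution_lipschitz[OF r y1] by metis
  \<comment> \<open>d and k bound the change of the starting term and of the kernel; D is the bound
    of \<open>volterra_compare\<close> for the residual d + k C B and L = 4 C + 1.\<close>
  define d where "d \<alpha> = (1 - \<alpha>) / Gamma (\<alpha> + 1) + \<bar>1 / Gamma (\<alpha> + 1) - 1\<bar>" for \<alpha> :: real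
  define k where "k \<alpha> = (1 - (2 * \<alpha> - 1)) / Gamma (2 * \<alpha>) + \<bar>1 / Gamma (2 * \<alpha>) - 1\<bar>" for \<alpha> :: real
  define D where "D \<alpha> = 2 * (d \<alpha> + k \<alpha> * C * B) * exp (4 * C + 1)" for \<alpha>
  have id: "((\<lambda>\<alpha>. \<alpha>) \<longlongrightarrow> 1) ?F" by (rule tendsto_ident_at)
  have G2: "Gamma (2::real) = 1" using Gamma_numeral[of "num.Bit0 num.One", where 'a = real] by simp
  have p: "(2::real) \<notin> \<int>\<^sub>\<le>\<^sub>0" "(1::real) \<notin> \<int>\<^sub>\<le>\<^sub>0" by (auto simp: nonpos_Ints_def)
  have g1: "((\<lambda>\<alpha>. Gamma (\<alpha> + 1)) \<longlongrightarrow> 1) ?F"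
    using tendsto_Gamma[of "\<lambda>\<alpha>. \<alpha> + 1" 2 ?F] tendsto_add[OF id tendsto_const[of 1]] p G2 by simp
  have g2: "((\<lambda>\<alpha>. Gamma (2 * \<alpha>)) \<longlongrightarrow> 1) ?F"
    using tendsto_Gamma[of "\<lambda>\<alpha>. 2 * \<alpha>" 2 ?F] tendsto_mult[OF tendsto_const[of 2] id] p G2 by simp
  have g3: "((\<lambda>\<alpha>. Gamma (2 - \<alpha>)) \<longlongrightarrow> 1) ?F"
    using tendsto_Gamma[of "\<lambda>\<alpha>. 2 - \<alpha>" 1 ?F] tendsto_diff[OF tendsto_const[of 2] id] p by simp
  have "(d \<longlongrightarrow> (1 - 1) / 1 + \<bar>1 / 1 - 1\<bar>) ?F"
    unfolding d_def by (intro tendsto_intros id g1) auto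
  moreover have "(k \<longlongrightarrow> (1 - (2 * 1 - 1)) / 1 + \<bar>1 / 1 - 1\<bar>) ?F"
    unfolding k_def by (intro tendsto_intros id g2) auto
  ultimately have "(D \<longlongrightarrow> 2 * (((1 - 1) / 1 + \<bar>1 / 1 - 1\<bar>)
      + ((1 - (2 * 1 - 1)) / 1 + \<bar>1 / 1 - 1\<bar>) * C * B) * exp (4 * C + 1)) ?F"
    unfolding D_def by (intro tendsto_intros)
  then have D: "(D \<longlongrightarrow> 0) ?F" by simp
  have "((\<lambda>\<alpha>. (D \<alpha> + \<Lambda> * (1 - \<alpha>)) / Gamma (2 - \<alpha>)) \<longlongrightarrow> (0 + \<Lambda> * (1 - 1)) / 1) ?F"
    by (intro tendsto_intros id g3 D) auto
  then have bound0: "((\<lambda>\<alpha>. (D \<alpha> + \<Lambda> * (1 - \<alpha>)) / Gamma (2 - \<alpha>)) \<longlongrightarrow> 0) ?F" by simp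
  \<comment> \<open>This bounds the kernels by 2, so one L serves all \<alpha> close to 1.\<close>
  have "\<forall>\<^sub>F \<alpha> in ?F. 1 / 2 < Gamma (2 * \<alpha>)" using g2 by (rule order_tendstoD) simp
  moreover have "\<forall>\<^sub>F \<alpha> in ?F. \<alpha> \<in> {1/2<..<1}" by (simp add: eventually_at_filter)
  ultimately have ev: "\<forall>\<^sub>F \<alpha> in ?F. norm (frac_trace \<alpha> (y \<alpha>) - y1 1 / Gamma (2 - \<alpha>))
      \<le> (D \<alpha> + \<Lambda> * (1 - \<alpha>)) / Gamma (2 - \<alpha>)"
  proof eventually_elim
    case (elim \<alpha>)
    then have \<alpha>: "1/2 < \<alpha>" "\<alpha> < 1" by auto
    have yc: "continuous_on UNIV (y \<alpha>)"
      and ys: "\<And>t. t \<in> {0..1} \<Longrightarrow> y \<alpha> t = frac_start \<alpha> t + volterra (frac_kernel \<alpha>) r (y \<alpha>) t"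
      using y[OF elim(2)] by (auto simp: frac_solution_def)
    have Ka: "causal_kernel (1 / Gamma (2 * \<alpha>)) (frac_kernel \<alpha>)" using \<alpha> by (intro causal_frac_kernel)
    have K1: "causal_kernel (1 / Gamma (2 * 1)) (frac_kernel 1)" by (rule causal_frac_kernel) simp
    have "1 / Gamma (2 * \<alpha>) \<le> 2" using elim(1) by (simp add: field_simps)
    then have L: "2 * (1 / Gamma (2 * \<alpha>)) * C \<le> 4 * C + 1"
      using mult_right_mono[of "1 / Gamma (2 * \<alpha>)" 2 "2 * C"] C by (simp add: algebra_simps)
    have close: "\<bar>y \<alpha> t - y1 t\<bar> \<le> D \<alpha>" if t: "t \<in> {0..1}" for t
      unfolding D_def
    proof (rule volterra_compare[OF Ka r yc y1c _ L ys _ t])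
      show "\<bar>frac_start \<alpha> t + volterra (frac_kernel \<alpha>) r y1 t - y1 t\<bar> \<le> d \<alpha> + k \<alpha> * C * B"
        if t: "t \<in> {0..1}" for t
      proof -
        have "\<bar>frac_start \<alpha> t - frac_start 1 t\<bar> \<le> d \<alpha>"
          using clamp01_powr_scaled_diff[of \<alpha> "Gamma (\<alpha> + 1)" t] \<alpha>
          unfolding d_def frac_start_1 by (simp add: frac_start_def)
        moreover have "\<bar>volterra (frac_kernel \<alpha>) r y1 t - volterra (frac_kernel 1) r y1 t\<bar> \<le> k \<alpha> * C * B"
        proof (rule volterra_kernel_diff[OF Ka K1 _ r y1c B])
          show "\<bar>frac_kernel \<alpha> u - frac_kernel 1 u\<bar> \<le> k \<alpha>" for u
            using clamp01_powr_scaled_diff[of "2 * \<alpha> - 1" "Gamma (2 * \<alpha>)" u] \<alpha>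
            unfolding k_def frac_kernel_1 by (simp add: frac_kernel_def)
        qed
        ultimately show ?thesis using y1s[OF t] by linarith
      qed
    qed (use C in auto)
    show ?case unfolding real_norm_def
    proof (rule frac_trace_approx[OF \<alpha>(2) yc _ \<Lambda>0])
      fix s :: real assume s: "s \<in> {0..1}"
      have "(1 - s) powr 1 \<le> (1 - s) powr \<alpha>" using s \<alpha> by (intro powr_mono') auto
      then have "\<Lambda> * (1 - s) \<le> \<Lambda> * (1 - s) powr \<alpha>" using s \<Lambda>0 by (intro mult_left_mono) auto
      then show "\<bar>y \<alpha> s - y1 1\<bar> \<le> D \<alpha> + \<Lambda> * (1 - s) powr \<alpha>"
        using close[OF s] \<Lambda>[OF s] by linarith
    qed
  qed
  have "((\<lambda>\<alpha>. frac_trace \<alpha> (y \<alpha>) - y1 1 / Gamma (2 - \<alpha>)) \<longlongrightarrow> 0) ?F"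
    by (rule Lim_null_comparison[OF ev bound0])
  moreover have "((\<lambda>\<alpha>. y1 1 / Gamma (2 - \<alpha>)) \<longlongrightarrow> y1 1 / 1) ?F"
    by (intro tendsto_intros g3) auto
  ultimately show ?thesis using tendsto_add by fastforce
qed

section \<open>Continuous dependence on the spectral parameter\<close>

definition spectral_density :: "(real \<Rightarrow> real) \<Rightarrow> real \<Rightarrow> real \<Rightarrow> real" where
  "spectral_density r \<mu> s = r s - \<mu> * indicator {0..1} s"

lemma unit_density_spectral:
  assumes "unit_density C r"
  shows "unit_density (C + \<bar>\<mu>\<bar>) (spectral_density r \<mu>)"
proof -
  note d = unit_densityD[OF assms]
  have [measurable]: "r \<in> borel_measurable borel" by (rule d)
  have "spectral_density r \<mu> \<in> borel_measurable borel" unfolding spectral_density_def by measurable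
  moreover have "\<bar>spectral_density r \<mu> s\<bar> \<le> (C + \<bar>\<mu>\<bar>) * indicator {0..1} s" for s
  proof (cases "s \<in> {0..1}")
    case True
    then show ?thesis using d(3)[of s] by (auto simp: spectral_density_def)
  qed (use d(5) in \<open>auto simp: spectral_density_def\<close>)
  ultimately show ?thesis by (simp add: unit_density_def)
qed

text \<open>The solution for \<mu> solves the equation for \<nu> with residual at most M |\<nu> -
  \<mu>| B, so the solutions, and with them the traces, differ by O(|\<nu> - \<mu>|).\<close>

lemma frac_trace_continuous_spectral:
  assumes \<alpha>: "1/2 < \<alpha>" "\<alpha> < 1" and r: "unit_density C r"
    and y: "\<And>\<mu>. frac_solution \<alpha> (spectral_density r \<mu>) (y \<mu>)"
  shows "isCont (\<lambda>\<mu>. frac_trace \<alpha> (y \<mu>)) \<mu>"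
proof -
  define M where "M = 1 / Gamma (2 * \<alpha>)"
  have K: "causal_kernel M (frac_kernel \<alpha>)" unfolding M_def by (rule causal_frac_kernel) fact
  have M: "0 \<le> M" using causal_kernelD(4)[OF K] .
  have C: "0 \<le> C" using unit_densityD(4)[OF r] .
  have yc: "continuous_on UNIV (y \<mu>)"
    and ys: "\<And>t. t \<in> {0..1} \<Longrightarrow>
      y \<mu> t = frac_start \<alpha> t + volterra (frac_kernel \<alpha>) (spectral_density r \<mu>) (y \<mu>) t" for \<mu>
    using y[of \<mu>] by (auto simp: frac_solution_def)
  obtain B where B0: "0 \<le> B" and B: "\<And>s. s \<in> {0..1} \<Longrightarrow> \<bar>y \<mu> s\<bar> \<le> B"
    using bounded_unit_interval[OF yc] by metis
  \<comment> \<open>The summand 1 next to |\<mu>| makes L valid for all \<nu> within distance 1 of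
    \<mu>.\<close>
  define L where "L = 2 * M * (C + \<bar>\<mu>\<bar> + 1) + 1"
  define D where "D \<nu> = 2 * (M * \<bar>\<nu> - \<mu>\<bar> * B) * exp L" for \<nu>
  have close: "\<bar>y \<nu> t - y \<mu> t\<bar> \<le> D \<nu>" if \<nu>: "\<bar>\<nu> - \<mu>\<bar> \<le> 1" and t: "t \<in> {0..1}" for \<nu> t
    unfolding D_def
  proof (rule volterra_compare[OF K unit_density_spectral[OF r] yc yc _ _ ys _ t])
    have "2 * M * (C + \<bar>\<nu>\<bar>) \<le> 2 * M * (C + \<bar>\<mu>\<bar> + 1)"
      using M \<nu> by (intro mult_left_mono) auto
    then show "2 * M * (C + \<bar>\<nu>\<bar>) \<le> L" by (simp add: L_def)
    show "0 < L" using M C by (auto simp: L_def intro!: add_nonneg_pos mult_nonneg_nonneg)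
    show "\<bar>frac_start \<alpha> t + volterra (frac_kernel \<alpha>) (spectral_density r \<nu>) (y \<mu>) t - y \<mu> t\<bar>
        \<le> M * \<bar>\<nu> - \<mu>\<bar> * B" if "t \<in> {0..1}" for t
      using volterra_density_diff[OF K unit_density_spectral[OF r] unit_density_spectral[OF r] _ yc B,
          of \<nu> \<mu> "\<bar>\<nu> - \<mu>\<bar>" t] ys[OF that, of \<mu>]
      by (simp add: spectral_density_def algebra_simps abs_minus_commute)
  qed
  have G: "Gamma (2 - \<alpha>) \<noteq> 0" using \<alpha> by (simp add: Gamma_real_neq_0)
  have w: "integrable lborel (\<lambda>s. indicator {0..1} s * (1 - s) powr (- \<alpha>) * y \<nu> s)" for \<nu>
    by (rule trace_integrable[OF \<alpha>(2) yc])
  have diff: "norm (frac_trace \<alpha> (y \<nu>) - frac_trace \<alpha> (y \<mu>)) \<le> D \<nu> / Gamma (2 - \<alpha>)"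
    if "\<bar>\<nu> - \<mu>\<bar> \<le> 1" for \<nu>
  proof -
    have "frac_trace \<alpha> (y \<nu>) - frac_trace \<alpha> (y \<mu>) = frac_trace \<alpha> (\<lambda>s. y \<nu> s - y \<mu> s)"
      using w[of \<nu>] w[of \<mu>] by (simp add: frac_trace_def right_diff_distrib)
    \<comment> \<open>With c = 0 and \<Lambda> = 0 the trace estimate is a sup norm bound.\<close>
    then show ?thesis
      using frac_trace_approx[OF \<alpha>(2), of "\<lambda>s. y \<nu> s - y \<mu> s" 0 "D \<nu>" 0] close[OF that] yc
      by (simp add: continuous_intros)
  qed
  have "((\<lambda>\<nu>. D \<nu> / Gamma (2 - \<alpha>)) \<longlongrightarrow> 2 * (M * \<bar>\<mu> - \<mu>\<bar> * B) * exp L / Gamma (2 - \<alpha>)) (at \<mu>)"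
    unfolding D_def by (intro tendsto_intros G)
  then have lim: "((\<lambda>\<nu>. D \<nu> / Gamma (2 - \<alpha>)) \<longlongrightarrow> 0) (at \<mu>)" by simp
  have "\<forall>\<^sub>F \<nu> in at \<mu>. norm (frac_trace \<alpha> (y \<nu>) - frac_trace \<alpha> (y \<mu>)) \<le> D \<nu> / Gamma (2 - \<alpha>)"
    unfolding eventually_at using diff by (intro exI[of _ 1]) (auto simp: dist_real_def)
  from Lim_null_comparison[OF this lim] show ?thesis
    by (simp add: isCont_def Lim_null[of "\<lambda>\<mu>. frac_trace \<alpha> (y \<mu>)"])
qed

section \<open>The classical problem for large spectral parameter\<close>

text \<open>The solution of y'' = - \<open>\<omega>\<^sup>2\<close> y with y(0) = 0, y'(0) = 1,
  continued by 0 to negative arguments.\<close>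

definition sine_kernel :: "real \<Rightarrow> real \<Rightarrow> real" where
  "sine_kernel \<omega> u = sin (\<omega> * max 0 u) / \<omega>"

lemma causal_sine_kernel:
  assumes "0 < \<omega>"
  shows "causal_kernel (1 / \<omega>) (sine_kernel \<omega>)"
  unfolding causal_kernel_def sine_kernel_def
proof (intro conjI allI impI)
  show "continuous_on UNIV (\<lambda>u. sin (\<omega> * max 0 u) / \<omega>)"
    using assms by (intro continuous_intros) auto
  show "\<bar>sin (\<omega> * max 0 u) / \<omega>\<bar> \<le> 1 / \<omega>" for u
    using assms by (simp add: divide_right_mono)
qed auto

lemma causal_clamp01: "causal_kernel 1 clamp01"
  using continuous_on_clamp01[OF continuous_on_id, of UNIV]
  by (auto simp: causal_kernel_def clamp01 id_def)

lemma unit_density_indicator: "unit_density 1 (indicator {0..1})"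
  by (simp add: unit_density_def)

lemma continuous_on_kernel_shift:
  "causal_kernel M K \<Longrightarrow> continuous_on UNIV (\<lambda>\<tau>. K (\<tau> - s))"
  by (rule continuous_on_compose2[OF causal_kernelD(1), where f = "\<lambda>\<tau>. \<tau> - s"])
    (auto intro: continuous_intros)

text \<open>\<open>sin (\<omega> u) / \<omega>\<close> is the resolvent of the kernel \<open>u\<close> at \<open>- \<omega>\<^sup>2\<close>.\<close>

lemma sine_kernel_resolvent:
  assumes \<omega>: "0 < \<omega>" and s: "s \<in> {0..1}" and t: "t \<in> {0..1}"
  shows "\<omega>\<^sup>2 * volterra clamp01 (indicator {0..1}) (\<lambda>\<tau>. sine_kernel \<omega> (\<tau> - s)) t
       = clamp01 (t - s) - sine_kernel \<omega> (t - s)"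
proof (cases "s < t")
  case False
  then have "clamp01 (t - \<tau>) * indicator {0..1} \<tau> * sine_kernel \<omega> (\<tau> - s) = 0" for \<tau>
    by (cases "\<tau> \<le> t") (auto simp: sine_kernel_def clamp01 max_def)
  then have "volterra clamp01 (indicator {0..1}) (\<lambda>\<tau>. sine_kernel \<omega> (\<tau> - s)) t = 0"
    by (simp only: volterra_def Bochner_Integration.integral_zero)
  then show ?thesis using False by (simp add: clamp01 sine_kernel_def)
next
  case True
  define g where "g \<tau> = (t - \<tau>) * sin (\<omega> * (\<tau> - s)) / \<omega>" for \<tau>
  \<comment> \<open>An antiderivative of g, found by integrating by parts once.\<close>
  define G where "G \<tau> = - (t - \<tau>) * cos (\<omega> * (\<tau> - s)) / \<omega>\<^sup>2 - sin (\<omega> * (\<tau> - s)) / \<omega> ^ 3" for \<tau>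
  \<comment> \<open>The cutoffs of the two causal kernels leave exactly the interval [s, t].\<close>
  have "clamp01 (t - \<tau>) * indicator {0..1} \<tau> * sine_kernel \<omega> (\<tau> - s) = indicator {s..t} \<tau> *\<^sub>R g \<tau>" for \<tau>
    using s t by (auto simp: clamp01_def sine_kernel_def g_def indicator_def max_def min_def)
  then have "volterra clamp01 (indicator {0..1}) (\<lambda>\<tau>. sine_kernel \<omega> (\<tau> - s)) t
      = (\<integral>\<tau>. indicator {s..t} \<tau> *\<^sub>R g \<tau> \<partial>lborel)"
    by (simp add: volterra_def)
  also have "\<dots> = G t - G s"
  proof (rule integral_FTC_Icc)
    show "continuous_on {s..t} g" unfolding g_def using \<omega> by (intro continuous_intros) auto
    fix \<tau>
    have "(G has_real_derivative g \<tau>) (at \<tau>)"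
      unfolding G_def g_def using \<omega>
      by (auto intro!: derivative_eq_intros simp: field_simps power2_eq_square power3_eq_cube)
    then show "(G has_vector_derivative g \<tau>) (at \<tau> within {s..t})"
      by (simp add: has_real_derivative_iff_has_vector_derivative has_vector_derivative_at_within)
  qed (use True in simp)
  finally show ?thesis
    using True \<omega> s t
    by (simp add: G_def clamp01 sine_kernel_def field_simps power2_eq_square power3_eq_cube)
qed

text \<open>Exchanging the integrals lets the outer operator act on the inner kernel alone, so an
  identity between kernels becomes one between operators.\<close>

lemma volterra_volterra_Fubini:
  assumes K: "causal_kernel M K" and r: "unit_density C r"
    and S: "causal_kernel M' S" and q: "unit_density C' q" and w: "continuous_on UNIV w"
  shows "volterra K r (volterra S q w) t = (\<integral>s. volterra K r (\<lambda>\<tau>. S (\<tau> - s)) t * q s * w s \<partial>lborel)"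
proof -
  obtain B where B0: "0 \<le> B" and B: "\<And>s. s \<in> {0..1} \<Longrightarrow> \<bar>w s\<bar> \<le> B"
    using bounded_unit_interval[OF w] by metis
  define f where "f \<tau> s = K (t - \<tau>) * r \<tau> * (S (\<tau> - s) * q s * w s)" for \<tau> s
  note [measurable] = causal_kernelD(5)[OF K] causal_kernelD(5)[OF S] unit_densityD(1)[OF r]
    unit_densityD(1)[OF q] borel_measurable_continuous_onI[OF w]
  have "integrable (lborel \<Otimes>\<^sub>M lborel) (case_prod f)"
  proof (rule Bochner_Integration.integrable_bound)
    have "emeasure (lborel \<Otimes>\<^sub>M lborel) ({0..1::real} \<times> {0..1::real}) = 1"
      by (simp add: lborel.emeasure_pair_measure_Times)
    then have "integrable (lborel \<Otimes>\<^sub>M lborel) (indicator ({0..1::real} \<times> {0..1::real}) :: _ \<Rightarrow> real)"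
      by (intro integrable_real_indicator) auto
    then show "integrable (lborel \<Otimes>\<^sub>M lborel)
        (\<lambda>x. M * C * (M' * C' * B) * indicator ({0..1::real} \<times> {0..1::real}) x)"
      by (intro integrable_mult_right) auto
    have "norm (f \<tau> s) \<le> norm (M * C * (M' * C' * B) * indicator ({0..1} \<times> {0..1}) (\<tau>, s))" for \<tau> s
    proof (cases "s \<in> {0..1}")
      case True
      have "\<bar>S (\<tau> - s) * q s * w s\<bar> \<le> M' * C' * B"
        using volterra_integrand_bound[OF S q, of w B "\<tau> - s" s] B True by simp
      \<comment> \<open>With s fixed, the inner factor is passed as a constant function, so the same
        integrand bound applies a second time.\<close>
      then have "\<bar>f \<tau> s\<bar> \<le> M * C * (M' * C' * B) * indicator {0..1} \<tau>"
        unfolding f_def by (rule volterra_integrand_bound[OF K r, where f = "\<lambda>_. S (\<tau> - s) * q s * w s"])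
      then show ?thesis using True by (simp add: indicator_times)
    next
      case False
      then show ?thesis using unit_densityD(5)[OF q, of s] by (simp add: f_def)
    qed
    then show "AE x in lborel \<Otimes>\<^sub>M lborel. norm (case_prod f x)
        \<le> norm (M * C * (M' * C' * B) * indicator ({0..1} \<times> {0..1}) x)"
      by auto
  qed (simp add: f_def split_beta')
  from lborel_pair.Fubini_integral[OF this]
  have "(\<integral>\<tau>. (\<integral>s. f \<tau> s \<partial>lborel) \<partial>lborel) = (\<integral>s. (\<integral>\<tau>. f \<tau> s \<partial>lborel) \<partial>lborel)" by simp
  moreover have "(\<integral>\<tau>. f \<tau> s \<partial>lborel) = volterra K r (\<lambda>\<tau>. S (\<tau> - s)) t * q s * w s" for s
  proof -
    have "f \<tau> s = (K (t - \<tau>) * r \<tau> * S (\<tau> - s)) * (q s * w s)" for \<tau>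
      by (simp add: f_def mult_ac)
    then show ?thesis
      unfolding volterra_def mult.assoc[of _ "q s" "w s"]
      by (simp only: Bochner_Integration.integral_mult_left_zero)
  qed
  ultimately show ?thesis by (simp add: f_def volterra_def)
qed

text \<open>The resolvent identity for the kernels, integrated against q w.\<close>

lemma volterra_sine_resolvent:
  assumes \<omega>: "0 < \<omega>" and q: "unit_density C q" and w: "continuous_on UNIV w" and t: "t \<in> {0..1}"
  shows "\<omega>\<^sup>2 * volterra clamp01 (indicator {0..1}) (volterra (sine_kernel \<omega>) q w) t
       = volterra clamp01 q w t - volterra (sine_kernel \<omega>) q w t"
proof -
  note S = causal_sine_kernel[OF \<omega>]
  let ?H = "\<lambda>s. volterra clamp01 (indicator {0..1}) (\<lambda>\<tau>. sine_kernel \<omega> (\<tau> - s)) t"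
  have "\<omega>\<^sup>2 * volterra clamp01 (indicator {0..1}) (volterra (sine_kernel \<omega>) q w) t
      = (\<integral>s. \<omega>\<^sup>2 * (?H s * q s * w s) \<partial>lborel)"
    by (simp add: volterra_volterra_Fubini[OF causal_clamp01 unit_density_indicator S q w])
  also have "\<dots> = (\<integral>s. clamp01 (t - s) * q s * w s - sine_kernel \<omega> (t - s) * q s * w s \<partial>lborel)"
  proof (intro Bochner_Integration.integral_cong refl)
    fix s
    show "\<omega>\<^sup>2 * (?H s * q s * w s) = clamp01 (t - s) * q s * w s - sine_kernel \<omega> (t - s) * q s * w s"
    proof (cases "s \<in> {0..1}")
      case True
      have "\<omega>\<^sup>2 * (?H s * q s * w s) = (\<omega>\<^sup>2 * ?H s) * q s * w s" by (simp add: mult_ac)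
      then show ?thesis using sine_kernel_resolvent[OF \<omega> True t] by (simp add: left_diff_distrib)
    qed (use unit_densityD(5)[OF q, of s] in simp)
  qed
  finally show ?thesis
    unfolding volterra_def
    using volterra_integrable[OF causal_clamp01 q w, of t] volterra_integrable[OF S q w, of t] by simp
qed

lemma volterra_spectral_density:
  assumes K: "causal_kernel M K" and q: "unit_density C q" and w: "continuous_on UNIV w"
  shows "volterra K (spectral_density q \<mu>) w t = volterra K q w t - \<mu> * volterra K (indicator {0..1}) w t"
proof -
  have "K (t - s) * spectral_density q \<mu> s * w s
      = K (t - s) * q s * w s - \<mu> * (K (t - s) * indicator {0..1} s * w s)" for s
    by (simp add: spectral_density_def algebra_simps)
  then show ?thesis
    using volterra_integrable[OF K q w, of t] volterra_integrable[OF K unit_density_indicator w, of t]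
    by (simp add: volterra_def)
qed

text \<open>Variation of parameters: w is built from the equation with the sine kernel. Applying
  \<open>\<omega>\<^sup>2\<close> times the operator of \<open>clamp01\<close> and the resolvent
  identities turns that into the classical equation. The sine kernel is O(1 / \<omega>), hence so is
  w, and the integral term is O(\<open>1 / \<omega>\<^sup>2\<close>).\<close>

lemma classical_solution_asymptotics:
  assumes q: "unit_density C q" and \<omega>: "0 < \<omega>" "2 * C \<le> \<omega>"
  obtains w where "frac_solution 1 (spectral_density q (\<omega>\<^sup>2)) w"
    "\<bar>w 1 - sin \<omega> / \<omega>\<bar> \<le> 2 * C * exp 1 / \<omega>\<^sup>2"
proof -
  note S = causal_sine_kernel[OF \<omega>(1)]
  have C: "0 \<le> C" using unit_densityD(4)[OF q] .
  \<comment> \<open>The form \<open>t - 0\<close> matches the resolvent identity at s = 0.\<close>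
  have Sc: "continuous_on UNIV (\<lambda>t. sine_kernel \<omega> (t - 0))" by (rule continuous_on_kernel_shift[OF S])
  obtain w where wc: "continuous_on UNIV w"
    and ws: "\<And>t. t \<in> {0..1} \<Longrightarrow> w t = sine_kernel \<omega> (t - 0) + volterra (sine_kernel \<omega>) q w t"
    using volterra_solution_exists[OF S q Sc] by metis
  let ?V = "volterra (sine_kernel \<omega>) q w"
  let ?J = "volterra clamp01 (indicator {0..1})"
  have Vc: "continuous_on UNIV ?V" by (rule volterra_continuous[OF S q wc])
  have "w t = frac_start 1 t + volterra (frac_kernel 1) (spectral_density q (\<omega>\<^sup>2)) w t"
    if t: "t \<in> {0..1}" for t
  proof -
    have "?J w t = ?J (\<lambda>t. sine_kernel \<omega> (t - 0) + ?V t) t"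
      by (rule volterra_cong[OF unit_density_indicator ws])
    also have "\<dots> = ?J (\<lambda>t. sine_kernel \<omega> (t - 0)) t + ?J ?V t"
      by (rule volterra_add[OF causal_clamp01 unit_density_indicator Sc Vc])
    finally have "\<omega>\<^sup>2 * ?J w t = \<omega>\<^sup>2 * ?J (\<lambda>t. sine_kernel \<omega> (t - 0)) t + \<omega>\<^sup>2 * ?J ?V t"
      by (simp add: distrib_left)
    also have "\<dots> = clamp01 t - sine_kernel \<omega> (t - 0) + (volterra clamp01 q w t - ?V t)"
      using sine_kernel_resolvent[OF \<omega>(1) _ t, of 0] volterra_sine_resolvent[OF \<omega>(1) q wc t] by simp
    finally have "\<omega>\<^sup>2 * ?J w t = clamp01 t + volterra clamp01 q w t - w t"
      using ws[OF t] by simp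
    moreover have "frac_kernel 1 = clamp01" by (rule ext) (rule frac_kernel_1)
    ultimately show ?thesis
      by (simp add: frac_start_1 volterra_spectral_density[OF causal_clamp01 q wc])
  qed
  then have sol: "frac_solution 1 (spectral_density q (\<omega>\<^sup>2)) w" using wc by (simp add: frac_solution_def)
  \<comment> \<open>Stability with L = 1, which \<open>2 * C \<le> \<omega>\<close> permits.\<close>
  have wb: "\<bar>w t\<bar> \<le> 2 * (1 / \<omega>) * exp 1" if "t \<in> {0..1}" for t
  proof (rule volterra_stability[OF S q wc _ _ _ that])
    show "2 * (1 / \<omega>) * C \<le> 1" using \<omega> by (simp add: field_simps)
    show "\<bar>w t - ?V t\<bar> \<le> 1 / \<omega>" if "t \<in> {0..1}" for t
      using ws[OF that] causal_kernelD(3)[OF S, of t] by simp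
  qed simp
  have "\<bar>?V 1\<bar> \<le> 1 / \<omega> * C * (2 * (1 / \<omega>) * exp 1)" by (rule volterra_bound[OF S q wc wb])
  moreover have "w 1 - sin \<omega> / \<omega> = ?V 1" using ws[of 1] by (simp add: sine_kernel_def)
  ultimately have "\<bar>w 1 - sin \<omega> / \<omega>\<bar> \<le> 2 * C * exp 1 / \<omega>\<^sup>2" by (simp add: power2_eq_square mult_ac)
  with sol show ?thesis by (rule that)
qed

lemma sin_half_odd_pi: "sin ((real k + 1/2) * pi) = (- 1) ^ k"
proof -
  have "(real k + 1/2) * pi = real k * pi + pi / 2" by (simp add: algebra_simps)
  then show ?thesis by (simp add: sin_add)
qed

lemma classical_solution_alternates:
  assumes q: "unit_density C q"
  obtains k0 where "\<And>k. k0 \<le> k \<Longrightarrow>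
    \<exists>w. frac_solution 1 (spectral_density q (((real k + 1/2) * pi)\<^sup>2)) w \<and> 0 < (- 1) ^ k * w 1"
proof -
  have C: "0 \<le> C" using unit_densityD(4)[OF q] .
  \<comment> \<open>From this size on, the error 2 C e / \<open>\<omega>\<^sup>2\<close> is smaller
    than the main term 1 / \<omega>, which then determines the sign.\<close>
  obtain k0 :: nat where k0: "2 * C * exp 1 < real k0" using reals_Archimedean2 by blast
  show ?thesis
  proof (rule that[of k0])
    fix k :: nat assume "k0 \<le> k"
    define \<omega> where "\<omega> = (real k + 1/2) * pi"
    have "real k * 1 \<le> (real k + 1/2) * pi" using pi_gt3 by (intro mult_mono) auto
    then have big: "2 * C * exp 1 < \<omega>" using k0 \<open>k0 \<le> k\<close> by (simp add: \<omega>_def)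
    have \<omega>0: "0 < \<omega>" by (simp add: \<omega>_def add_nonneg_pos)
    have "2 * C * 1 \<le> 2 * C * exp 1" using C by (intro mult_left_mono) auto
    with big have "2 * C \<le> \<omega>" by simp
    from classical_solution_asymptotics[OF q \<omega>0 this]
    obtain w where w: "frac_solution 1 (spectral_density q (\<omega>\<^sup>2)) w"
      and le: "\<bar>w 1 - sin \<omega> / \<omega>\<bar> \<le> 2 * C * exp 1 / \<omega>\<^sup>2" .
    have s: "sin \<omega> = (- 1) ^ k" unfolding \<omega>_def by (rule sin_half_odd_pi)
    have "2 * C * exp 1 / \<omega>\<^sup>2 < 1 / \<omega>"
      using big \<omega>0 by (simp add: field_simps power2_eq_square)
    then have "\<bar>w 1 - (- 1) ^ k / \<omega>\<bar> < 1 / \<omega>" using le s by simp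
    then have "0 < (- 1) ^ k * w 1" by (cases "even k") auto
    with w show "\<exists>w. frac_solution 1 (spectral_density q (((real k + 1/2) * pi)\<^sup>2)) w \<and> 0 < (- 1) ^ k * w 1"
      unfolding \<omega>_def by blast
  qed
qed

section \<open>Eigenvalues\<close>

text \<open>The potential is only Lebesgue measurable and essentially bounded. A Borel version
  bounded everywhere leaves all integrals unchanged and fits the Volterra theory.\<close>

lemma borel_representative:
  assumes "L_infinity_01 q"
  obtains C q' where "unit_density C q'"
    "(\<lambda>s. indicator {0..1} s * q s) \<in> borel_measurable lebesgue"
    "AE s in lebesgue. indicator {0..1} s * q s = q' s"
proof -
  from assms obtain C where m: "q \<in> borel_measurable (lebesgue_on {0..1})"
    and C: "AE s in lebesgue_on {0..1}. \<bar>q s\<bar> \<le> C"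
    by (auto simp: L_infinity_01_def)
  have m': "(\<lambda>s. indicator {0..1} s * q s) \<in> borel_measurable lebesgue"
    using m borel_measurable_restrict_space_iff[of "{0..1}" lebesgue q] by (simp add: mult.commute)
  obtain g where g [measurable]: "g \<in> borel_measurable lborel"
    and ae: "AE s in lborel. indicator {0..1} s * q s = g s"
    using completion_ex_borel_measurable_real[OF m'] by blast
  have C': "AE s in lebesgue. s \<in> {0..1} \<longrightarrow> \<bar>q s\<bar> \<le> C"
    using C by (subst (asm) AE_restrict_space_iff) auto
  \<comment> \<open>Truncation turns the essential bound into a bound everywhere; |C| makes the
    truncation interval nonempty whatever the sign of C.\<close>
  define q' where "q' s = indicator {0..1} s * max (- \<bar>C\<bar>) (min \<bar>C\<bar> (g s))" for s
  have "q' \<in> borel_measurable borel" unfolding q'_def using g by simp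
  then have "unit_density \<bar>C\<bar> q'"
    by (auto simp: unit_density_def q'_def indicator_def)
  moreover have "AE s in lebesgue. indicator {0..1} s * q s = q' s"
    using C' AE_completion[OF ae]
  proof eventually_elim
    case (elim s)
    then show ?case by (cases "s \<in> {0..1}") (auto simp: q'_def)
  qed
  ultimately show ?thesis using m' by (intro that)
qed

text \<open>Passes from the real convolution over the line to the complex Lebesgue integral over
  [0, t]; the integrands A and G agree almost everywhere.\<close>

lemma frac_solution_imp_is_solution:
  assumes \<alpha>: "1/2 < \<alpha>" and q': "unit_density C q'"
    and m: "(\<lambda>s. indicator {0..1} s * q s) \<in> borel_measurable lebesgue"
    and ae: "AE s in lebesgue. indicator {0..1} s * q s = q' s"
    and y: "frac_solution \<alpha> (spectral_density q' \<mu>) y"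
  shows "is_solution \<alpha> q (complex_of_real \<mu>) (\<lambda>s. complex_of_real (y s))"
  unfolding is_solution_def
proof (intro conjI exI ballI)
  have yc: "continuous_on UNIV y"
    and ys: "\<And>t. t \<in> {0..1} \<Longrightarrow>
      y t = frac_start \<alpha> t + volterra (frac_kernel \<alpha>) (spectral_density q' \<mu>) y t"
    using y by (auto simp: frac_solution_def)
  show "continuous_on {0..1} (\<lambda>s. complex_of_real (y s))"
    using continuous_on_subset[OF yc] by (intro continuous_intros) auto
  fix t :: real assume t: "t \<in> {0..1}"
  define A where "A s = indicator {0..t} s * (t - s) powr (2 * \<alpha> - 1) * (indicator {0..1} s * q s - \<mu>) * y s" for s
  define G where "G s = Gamma (2 * \<alpha>) * (frac_kernel \<alpha> (t - s) * spectral_density q' \<mu> s * y s)" for s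
  have [measurable]: "y \<in> borel_measurable borel" using yc by (rule borel_measurable_continuous_onI)
  have ym: "y \<in> borel_measurable lebesgue"
    "(\<lambda>s. indicator {0..t} s * (t - s) powr (2 * \<alpha> - 1)) \<in> borel_measurable lebesgue"
    by (rule measurable_completion, simp)+
  have A: "A \<in> borel_measurable lebesgue"
    unfolding A_def
    by (intro borel_measurable_times[OF borel_measurable_times[OF ym(2) borel_measurable_diff[OF m]] ym(1)])
      simp
  have [measurable]: "frac_kernel \<alpha> \<in> borel_measurable borel"
      "spectral_density q' \<mu> \<in> borel_measurable borel"
    using causal_kernelD(5)[OF causal_frac_kernel[OF \<alpha>]]
      unit_densityD(1)[OF unit_density_spectral[OF q']] by auto
  have G: "G \<in> borel_measurable lborel" unfolding G_def by measurable
  have G0: "Gamma (2 * \<alpha>) \<noteq> 0" using \<alpha> by (simp add: Gamma_real_neq_0)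
  have "AE s in lebesgue. A s = G s"
    using ae
  proof eventually_elim
    case (elim s)
    \<comment> \<open>A vanishes off [0, t]; G vanishes to the left by its density and to the right
      by its kernel.\<close>
    consider "s \<in> {0..t}" | "s < 0" | "t < s" by force
    then show ?case
    proof cases
      case 1
      then show ?thesis using elim t G0
        by (simp add: A_def G_def frac_kernel_def clamp01 spectral_density_def)
    next
      case 2
      then have "spectral_density q' \<mu> s = 0"
        using unit_densityD(5)[OF unit_density_spectral[OF q'], of s] by simp
      then show ?thesis using 2 by (simp add: A_def G_def)
    next
      case 3
      then show ?thesis by (simp add: A_def G_def frac_kernel_def clamp01)
    qed
  qed
  then have "integral\<^sup>L lebesgue A = integral\<^sup>L lebesgue G"
    using A measurable_completion[OF G] by (intro integral_cong_AE)
  also have "\<dots> = integral\<^sup>L lborel G" by (rule integral_completion[OF G])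
  also have "\<dots> = Gamma (2 * \<alpha>) * volterra (frac_kernel \<alpha>) (spectral_density q' \<mu>) y t"
    unfolding G_def volterra_def by (rule Bochner_Integration.integral_mult_right_zero)
  finally have int: "integral\<^sup>L lebesgue A = Gamma (2 * \<alpha>) * volterra (frac_kernel \<alpha>) (spectral_density q' \<mu>) y t" .
  have "(LINT s:{0..t}|lebesgue. complex_of_real ((t - s) powr (2 * \<alpha> - 1)) *
      ((complex_of_real (q s) - complex_of_real \<mu>) * complex_of_real (y s)))
      = (\<integral>s. complex_of_real (A s) \<partial>lebesgue)"
    unfolding set_lebesgue_integral_def
    by (intro Bochner_Integration.integral_cong) (use t in \<open>auto simp: A_def indicator_def\<close>)
  also have "\<dots> = complex_of_real (Gamma (2 * \<alpha>) * volterra (frac_kernel \<alpha>) (spectral_density q' \<mu>) y t)"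
    using int by simp
  \<comment> \<open>The factor 1 is the witness for \<open>c\<^sub>2\<close>.\<close>
  finally show "complex_of_real (y t) = 1 * complex_of_real (t powr \<alpha> / Gamma (\<alpha> + 1))
      + RL_integral (2 * \<alpha>) (\<lambda>s. (complex_of_real (q s) - complex_of_real \<mu>) * complex_of_real (y s)) t"
    using ys[OF t] t G0 by (simp add: RL_integral_def frac_start_def clamp01)
qed

lemma RL_integral_eq_frac_trace:
  assumes "continuous_on UNIV y"
  shows "RL_integral (1 - \<alpha>) (\<lambda>s. complex_of_real (y s)) 1 = complex_of_real (frac_trace \<alpha> y)"
proof -
  have [measurable]: "y \<in> borel_measurable borel" using assms by (rule borel_measurable_continuous_onI)
  have "(LINT s:{0..1}|lebesgue. complex_of_real ((1 - s) powr (1 - \<alpha> - 1)) * complex_of_real (y s))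
      = (\<integral>s. complex_of_real (indicator {0..1} s * (1 - s) powr (- \<alpha>) * y s) \<partial>lebesgue)"
    unfolding set_lebesgue_integral_def
    by (intro Bochner_Integration.integral_cong) (auto simp: indicator_def)
  also have "\<dots> = complex_of_real (\<integral>s. indicator {0..1} s * (1 - s) powr (- \<alpha>) * y s \<partial>lebesgue)"
    by (rule integral_complex_of_real)
  also have "(\<integral>s. indicator {0..1} s * (1 - s) powr (- \<alpha>) * y s \<partial>lebesgue)
      = (\<integral>s. indicator {0..1} s * (1 - s) powr (- \<alpha>) * y s \<partial>lborel)"
    by (rule integral_completion) measurable
  finally show ?thesis by (simp add: RL_integral_def frac_trace_def)
qed

text \<open>The solution is nontrivial: if it vanished on [0, 1], the equation at t = 1 would give
  \<open>1 / Gamma (\<alpha> + 1) = 0\<close>.\<close>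

lemma frac_solution_imp_is_eigenvalue:
  assumes \<alpha>: "1/2 < \<alpha>" and q': "unit_density C q'"
    and m: "(\<lambda>s. indicator {0..1} s * q s) \<in> borel_measurable lebesgue"
    and ae: "AE s in lebesgue. indicator {0..1} s * q s = q' s"
    and y: "frac_solution \<alpha> (spectral_density q' \<mu>) y" and tr: "frac_trace \<alpha> y = 0"
  shows "is_eigenvalue \<alpha> q (complex_of_real \<mu>)"
proof -
  have "\<exists>t\<in>{0..1}. y t \<noteq> 0"
  proof (rule ccontr)
    assume "\<not> ?thesis"
    then have 0: "\<And>t. t \<in> {0..1} \<Longrightarrow> y t = 0" by auto
    have "volterra (frac_kernel \<alpha>) (spectral_density q' \<mu>) y 1
        = volterra (frac_kernel \<alpha>) (spectral_density q' \<mu>) (\<lambda>_. 0) 1"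
      by (rule volterra_cong[OF unit_density_spectral[OF q'] 0])
    then have "y 1 = frac_start \<alpha> 1" using y by (simp add: frac_solution_def volterra_def)
    then show False using 0[of 1] \<alpha> by (simp add: frac_start_def clamp01 Gamma_real_neq_0)
  qed
  moreover have "continuous_on UNIV y" using y by (simp add: frac_solution_def)
  ultimately show ?thesis
    using frac_solution_imp_is_solution[OF \<alpha> q' m ae y] tr
    unfolding is_eigenvalue_def
    by (intro exI[of _ "\<lambda>s. complex_of_real (y s)"]) (simp add: RL_integral_eq_frac_trace)
qed

text \<open>The zeros lie in disjoint consecutive intervals, so they are distinct.\<close>

lemma alternating_signs_imp_zeros:
  fixes F x :: "_ \<Rightarrow> real"
  assumes cont: "\<And>\<mu>. isCont F \<mu>" and x: "\<And>k::nat. x k < x (Suc k)"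
    and sgn: "\<And>k. k0 \<le> k \<Longrightarrow> k \<le> k0 + n \<Longrightarrow> 0 < (- 1) ^ k * F (x k)"
  obtains Z where "finite Z" "card Z = n" "\<And>z. z \<in> Z \<Longrightarrow> F z = 0"
proof -
  have "\<exists>z. x k < z \<and> z < x (Suc k) \<and> F z = 0" if k: "k0 \<le> k" "k < k0 + n" for k
  proof -
    let ?h = "\<lambda>z. (- 1) ^ k * F z"
    have s: "0 < ?h (x k)" "?h (x (Suc k)) < 0"
      using sgn[of k] sgn[of "Suc k"] k by auto
    have "\<exists>z\<ge>x k. z \<le> x (Suc k) \<and> ?h z = 0"
    proof (rule IVT2')
      show "continuous_on {x k..x (Suc k)} ?h"
        using cont by (intro continuous_intros continuous_at_imp_continuous_on) auto
    qed (use s x[of k] in auto)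
    then obtain z where z: "x k \<le> z" "z \<le> x (Suc k)" "?h z = 0" by blast
    \<comment> \<open>The signs at the endpoints are strict, so z is interior; this makes the zeros
      from adjacent intervals distinct.\<close>
    moreover have "z \<noteq> x k" "z \<noteq> x (Suc k)" using s z(3) by auto
    ultimately show ?thesis by (intro exI[of _ z]) auto
  qed
  then have "\<forall>k. \<exists>z. k0 \<le> k \<and> k < k0 + n \<longrightarrow> x k < z \<and> z < x (Suc k) \<and> F z = 0" by blast
  then obtain g where g: "\<And>k. k0 \<le> k \<Longrightarrow> k < k0 + n \<Longrightarrow> x k < g k \<and> g k < x (Suc k) \<and> F (g k) = 0"
    by metis
  have mono: "x i \<le> x j" if "i \<le> j" for i j
    by (rule lift_Suc_mono_le[of x, OF less_imp_le[OF x] that])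
  have "inj_on g {k0..<k0 + n}"
  proof (rule linorder_inj_onI)
    fix i j assume ij: "i < j" "i \<in> {k0..<k0 + n}" "j \<in> {k0..<k0 + n}"
    then have "g i < x (Suc i)" "x (Suc i) \<le> x j" "x j < g j"
      using g[of i] g[of j] mono[of "Suc i" j] by auto
    then show "g i \<noteq> g j" by linarith
  qed auto
  then have "card (g ` {k0..<k0 + n}) = n" by (simp add: card_image)
  moreover have "F z = 0" if "z \<in> g ` {k0..<k0 + n}" for z using that g by auto
  ultimately show ?thesis by (intro that[of "g ` {k0..<k0 + n}"]) auto
qed

theorem mainTheorem2:
  fixes q :: "real \<Rightarrow> real"
  assumes "L_infinity_01 q"
  shows "((\<lambda>\<alpha>. num_real_eigenvalues q \<alpha>) \<longlongrightarrow> \<infinity>) (at 1 within {1/2<..<1})"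
proof (rule order_tendstoI)
  fix a :: enat assume "a < \<infinity>"
  then obtain N where N: "a = enat N" by (cases a) auto
  obtain C q' where q': "unit_density C q'"
    and m: "(\<lambda>s. indicator {0..1} s * q s) \<in> borel_measurable lebesgue"
    and ae: "AE s in lebesgue. indicator {0..1} s * q s = q' s"
    using borel_representative[OF assms] by blast
  define x where "x k = ((real k + 1/2) * pi)\<^sup>2" for k :: nat
  have x: "x k < x (Suc k)" for k unfolding x_def by (intro power_strict_mono) auto
  \<comment> \<open>Any choice of solutions will do, since the limit and continuity results hold for
    every family of solutions.\<close>
  define Y where "Y \<alpha> \<mu> = (SOME y. frac_solution \<alpha> (spectral_density q' \<mu>) y)" for \<alpha> \<mu>
  have Y: "frac_solution \<alpha> (spectral_density q' \<mu>) (Y \<alpha> \<mu>)" if "1/2 < \<alpha>" for \<alpha> \<mu>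
    unfolding Y_def
    using frac_solution_exists[OF that unit_density_spectral[OF q'], of \<mu>] by (metis someI_ex)
  obtain k0 where k0: "\<And>k. k0 \<le> k \<Longrightarrow>
      \<exists>w. frac_solution 1 (spectral_density q' (x k)) w \<and> 0 < (- 1) ^ k * w 1"
    using classical_solution_alternates[OF q'] unfolding x_def by blast
  let ?F = "at 1 within {1/2<..<1::real}"
  have "\<forall>\<^sub>F \<alpha> in ?F. 0 < (- 1) ^ k * frac_trace \<alpha> (Y \<alpha> (x k))" if k: "k0 \<le> k" for k
  proof -
    obtain w where w: "frac_solution 1 (spectral_density q' (x k)) w" "0 < (- 1) ^ k * w 1"
      using k0[OF k] by blast
    have "((\<lambda>\<alpha>. frac_trace \<alpha> (Y \<alpha> (x k))) \<longlongrightarrow> w 1) ?F"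
      using Y by (intro frac_trace_tendsto[OF unit_density_spectral[OF q'] w(1)]) auto
    then have "((\<lambda>\<alpha>. (- 1) ^ k * frac_trace \<alpha> (Y \<alpha> (x k))) \<longlongrightarrow> (- 1) ^ k * w 1) ?F"
      by (intro tendsto_intros)
    then show ?thesis using w(2) by (rule order_tendstoD)
  qed
  \<comment> \<open>These N + 2 sign conditions yield N + 1 zeros, one more than N; being finitely
    many, they hold simultaneously near 1.\<close>
  then have "\<forall>\<^sub>F \<alpha> in ?F. \<forall>k\<in>{k0..k0 + Suc N}. 0 < (- 1) ^ k * frac_trace \<alpha> (Y \<alpha> (x k))"
    by (intro eventually_ball_finite) auto
  moreover have "\<forall>\<^sub>F \<alpha> in ?F. \<alpha> \<in> {1/2<..<1}" by (simp add: eventually_at_filter)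
  ultimately show "\<forall>\<^sub>F \<alpha> in ?F. a < num_real_eigenvalues q \<alpha>"
  proof eventually_elim
    case (elim \<alpha>)
    then have \<alpha>: "1/2 < \<alpha>" "\<alpha> < 1" by auto
    have cont: "isCont (\<lambda>\<mu>. frac_trace \<alpha> (Y \<alpha> \<mu>)) \<mu>" for \<mu>
      using Y[OF \<alpha>(1)] by (rule frac_trace_continuous_spectral[OF \<alpha> q'])
    have "0 < (- 1) ^ k * frac_trace \<alpha> (Y \<alpha> (x k))" if "k0 \<le> k" "k \<le> k0 + Suc N" for k
      using elim(1) that by auto
    from alternating_signs_imp_zeros[OF cont x this]
    obtain Z where Z: "finite Z" "card Z = Suc N"
      and zero: "\<And>z. z \<in> Z \<Longrightarrow> frac_trace \<alpha> (Y \<alpha> z) = 0"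
      by blast
    let ?E = "{\<mu>::complex. \<mu> \<in> \<real> \<and> is_eigenvalue \<alpha> q \<mu>}"
    have sub: "complex_of_real ` Z \<subseteq> ?E"
      using frac_solution_imp_is_eigenvalue[OF \<alpha>(1) q' m ae Y[OF \<alpha>(1)] zero] by auto
    \<comment> \<open>For infinite \<open>?E\<close> the count is \<infinity> and exceeds N
      anyway.\<close>
    have "Suc N \<le> card ?E" if "finite ?E"
      using card_mono[OF that sub] Z by (simp add: card_image inj_on_def)
    then show ?case by (auto simp: num_real_eigenvalues_def N Let_def)
  qed
qed simp

end
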